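(* Let $d\ge 2$ and let $\nu_{d-1}$ be a probability measure on $(0,\infty)$, regarded as the radius distribution of the sectional balls within a totally geodesic hypersurface $L$ of the $d$-dimensional space $\mathbb{M}_k^d$ of constant curvature $k$ (the same $\nu_{d-1}$ for all $k$). Let $K\subset\mathbb{R}$ be the set of all $k$ for which $\nu_{d-1}$ arises from some radius distribution in $\mathbb{M}_k^d$, and for $k\in K$ let $\nu_d^{(k)}$ be that radius distribution, i.e. the distribution of the radii of the balls in $\mathbb{M}_k^d$ arising from unfolding the process in $L$ (see the context for the precise definitions). Assume that $0\in K$ and that $0$ is an accumulation point of $K$. Then $$\nu_d^{(k)}\xrightarrow[k\to 0,\ k\in K\setminus\{0\}]{w}\nu_d^{(0)},$$ i.e. $\nu_d^{(k)}$ converges weakly to $\nu_d^{(0)}$ as the curvature $k$ tends to $0$.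
   Context: Conventions. $l_k:=\frac{\pi}{2\sqrt{k}}$ if $k>0$ and $l_k:=\infty$ if $k\le 0$; if $l_k=\infty$, $(r,l_k]$ means $(r,\infty)$. The symbol $\cos(\sqrt{k}\,h)$ means the usual cosine if $k>0$, $1$ if $k=0$, and $\cosh(\sqrt{-k}\,h)$ if $k<0$. For $0\le|h|\le t\le l_k$ (with $t<\infty$), $$\alpha_k(t,h):=\begin{cases}\frac{1}{\sqrt{-k}}\operatorname{arcosh}\!\left(\frac{\cosh(\sqrt{-k}\,t)}{\cosh(\sqrt{-k}\,h)}\right), & k<0,\\[2pt] \sqrt{t^2-h^2}, & k=0,\\[2pt] \frac{1}{\sqrt{k}}\arccos\!\left(\frac{\cos(\sqrt{k}\,t)}{\cos(\sqrt{k}\,h)}\right), & k>0.\end{cases}$$ Setting. $\mathbb{M}_k^d$ is the sphere of radius $1/\sqrt{k}$ ($k>0$), $\mathbb{R}^d$ ($k=0$), or hyperbolic space of curvature $k$ ($k<0$). Consider balls centred at the points of a point process in $\mathbb{M}_k^d$ with isometry-invariant law and finite positive intensity, with independent radii of law $\nu$, where $\nu$ is a probability measure on $(0,\infty)$ concentrated on $(0,l_k]$. Intersecting these balls with $L$ yields a process of balls in $L$. If $$m_k(\nu):=\int_{(0,l_k]}\int_{-R}^{R}\cos^{d-1}(\sqrt{k}\,h)\,\mathrm{d}h\,\nu(\mathrm{d}R)<\infty$$ ($m_k(\nu)$ is the ratio of the intensity of the section process to that of the original process), then the radius distribution of the section process is the probability measure $S_k(\nu)$ on $(0,\infty)$,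 concentrated on $(0,l_k]$, determined by $$S_k(\nu)((r,l_k])=\frac{1}{m_k(\nu)}\int_{(r,l_k]}\int_{-\alpha_k(R,r)}^{\alpha_k(R,r)}\cos^{d-1}(\sqrt{k}\,h)\,\mathrm{d}h\,\nu(\mathrm{d}R),\qquad 0\le r<l_k.$$ Unfolding. $K$ is the set of $k\in\mathbb{R}$ for which there is a probability measure $\nu$ on $(0,\infty)$, concentrated on $(0,l_k]$, with $m_k(\nu)<\infty$ and $S_k(\nu)=\nu_{d-1}$. Such a $\nu$ is uniquely determined by $\nu_{d-1}$ and $k$, and is denoted $\nu_d^{(k)}$. *)

theory Defs
  imports "HOL-Probability.Probability"
begin

definition max_radius :: "real \<Rightarrow> ereal" where
  "max_radius k = (if k > 0 then ereal (pi / (2 * sqrt k)) else \<infinity>)"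

text \<open>The interval \<open>(r, l\<^sub>k]\<close> of reals, which is \<open>(r, \<infinity>)\<close> if \<open>k \<le> 0\<close>.\<close>

definition radii_above :: "real \<Rightarrow> real \<Rightarrow> real set" where
  "radii_above k r = {x. r < x \<and> ereal x \<le> max_radius k}"

text \<open>\<open>cos (\<surd>k h)\<close>, including its reading for \<open>k \<le> 0\<close>.\<close>

definition gcos :: "real \<Rightarrow> real \<Rightarrow> real" where
  "gcos k h = (if k > 0 then cos (sqrt k * h)
               else if k = 0 then 1
               else cosh (sqrt (- k) * h))"

text \<open>Only meaningful for \<open>0 \<le> \<bar>h\<bar> \<le> t \<le> l\<^sub>k\<close>; all uses below are in this range.\<close>

definition alpha :: "real \<Rightarrow> real \<Rightarrow> real \<Rightarrow> real" where
  "alpha k t h =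
     (if k < 0 then arcosh (cosh (sqrt (- k) * t) / cosh (sqrt (- k) * h)) / sqrt (- k)
      else if k = 0 then sqrt (t\<^sup>2 - h\<^sup>2)
      else arccos (cos (sqrt k * t) / cos (sqrt k * h)) / sqrt k)"

text \<open>Integrals are taken in \<^typ>\<open>ennreal\<close>; no mass is lost by truncating negative values,
  since \<open>gcos k h \<ge> 0\<close> for \<open>\<bar>h\<bar> \<le> a \<le> l\<^sub>k\<close>.\<close>

definition gcos_integral :: "nat \<Rightarrow> real \<Rightarrow> real \<Rightarrow> ennreal" where
  "gcos_integral d k a = (\<integral>\<^sup>+h\<in>{- a..a}. ennreal (gcos k h ^ (d - 1)) \<partial>lborel)"

definition section_mass :: "nat \<Rightarrow> real \<Rightarrow> real measure \<Rightarrow> ennreal" where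
  "section_mass d k \<nu> = (\<integral>\<^sup>+R\<in>radii_above k 0. gcos_integral d k R \<partial>\<nu>)"

text \<open>A radius law is a Borel probability measure on the real line that is concentrated on
  \<open>(0, l\<^sub>k]\<close>.\<close>

definition radius_law :: "real \<Rightarrow> real measure \<Rightarrow> bool" where
  "radius_law k \<nu> \<longleftrightarrow> real_distribution \<nu> \<and> (AE R in \<nu>. R \<in> radii_above k 0)"

text \<open>\<open>is_section_law d k \<nu> \<mu>\<close> expresses \<open>S\<^sub>k(\<nu>) = \<mu>\<close>. The measure \<open>S\<^sub>k(\<nu>)\<close> is specified by its
  tails, so it is rendered as a relation; it is functional by
  \<open>is_section_law_unique\<close>.\<close>

definition is_section_law :: "nat \<Rightarrow> real \<Rightarrow> real measure \<Rightarrow> real measure \<Rightarrow> bool" where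
  "is_section_law d k \<nu> \<mu> \<longleftrightarrow>
     radius_law k \<mu> \<and>
     (\<forall>r. 0 \<le> r \<and> ereal r < max_radius k \<longrightarrow>
        emeasure \<mu> (radii_above k r) =
          (\<integral>\<^sup>+R\<in>radii_above k r. gcos_integral d k (alpha k R r) \<partial>\<nu>) / section_mass d k \<nu>)"

definition is_unfolding :: "nat \<Rightarrow> real \<Rightarrow> real measure \<Rightarrow> real measure \<Rightarrow> bool" where
  "is_unfolding d k \<mu> \<nu> \<longleftrightarrow>
     radius_law k \<nu> \<and> section_mass d k \<nu> < \<infinity> \<and> is_section_law d k \<nu> \<mu>"

definition admissible_curvatures :: "nat \<Rightarrow> real measure \<Rightarrow> real set" where
  "admissible_curvatures d \<mu> = {k. \<exists>\<nu>. is_unfolding d k \<mu> \<nu>}"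

text \<open>Weak convergence along an arbitrary filter; the library's \<^const>\<open>weak_conv_m\<close> covers
  sequences only and is recovered in \<open>weakly_tendsto_sequentially_iff\<close>.\<close>

definition weakly_tendsto :: "('i \<Rightarrow> real measure) \<Rightarrow> real measure \<Rightarrow> 'i filter \<Rightarrow> bool" where
  "weakly_tendsto M N F \<longleftrightarrow>
     (\<forall>f :: real \<Rightarrow> real. continuous_on UNIV f \<and> bounded (range f) \<longrightarrow>
        ((\<lambda>i. \<integral>x. f x \<partial>M i) \<longlongrightarrow> (\<integral>x. f x \<partial>N)) F)"

lemma is_section_law_unique:
  assumes "is_section_law d k \<nu> \<mu>" and "is_section_law d k \<nu> \<mu>'"
  shows "\<mu> = \<mu>'"
proof -
  have law: "radius_law k \<mu>" "radius_law k \<mu>'"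
    using assms by (auto simp: is_section_law_def)
  interpret A: real_distribution \<mu> using law by (simp add: radius_law_def)
  interpret B: real_distribution \<mu>' using law by (simp add: radius_law_def)
  have meas: "radii_above k x \<in> sets borel" for x
    unfolding radii_above_def by measurable
  have cdf_eq: "cdf M x = 1 - (if 0 \<le> x then measure M (radii_above k x) else 1)"
    if M: "radius_law k M" for M x
  proof -
    interpret M: real_distribution M using M by (simp add: radius_law_def)
    have ae: "AE R in M. R \<in> radii_above k 0" using M by (simp add: radius_law_def)
    have s: "cdf M x = 1 - measure M {x<..}"
      using M.prob_compl[of "{x<..}"] unfolding cdf_def
      by (simp add: Compl_eq_Diff_UNIV[symmetric])
    show ?thesis
    proof (cases "0 \<le> x")
      case True
      have "measure M {x<..} = measure M (radii_above k x)"
        by (rule M.finite_measure_eq_AE) (use ae True meas in \<open>auto simp: radii_above_def\<close>)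
      with s True show ?thesis by simp
    next
      case False
      have "measure M {x<..} = measure M UNIV"
        by (rule M.finite_measure_eq_AE) (use ae False in \<open>auto simp: radii_above_def\<close>)
      with s False M.prob_space show ?thesis by simp
    qed
  qed
  have tail: "measure \<mu> (radii_above k x) = measure \<mu>' (radii_above k x)" if "0 \<le> x" for x
  proof (cases "ereal x < max_radius k")
    case True
    with assms that show ?thesis by (simp add: is_section_law_def measure_def)
  next
    case False
    then have "radii_above k x = {}"
      unfolding radii_above_def by (auto simp: not_less)
        (meson ereal_less_eq(3) leD order_trans)
    then show ?thesis by simp
  qed
  have "cdf \<mu> = cdf \<mu>'"
    using cdf_eq[OF law(1)] cdf_eq[OF law(2)] tail by auto
  then show ?thesis
    by (rule cdf_unique[OF A.real_distribution_axioms B.real_distribution_axioms])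
qed

lemma weakly_tendsto_sequentially_iff:
  assumes "\<And>n. real_distribution (M n)" and "real_distribution N"
  shows "weakly_tendsto M N sequentially \<longleftrightarrow> weak_conv_m M N"
proof
  assume *: "weakly_tendsto M N sequentially"
  show "weak_conv_m M N"
  proof (rule integral_cts_step_conv_imp_weak_conv[OF assms])
    fix x y :: real assume "x < y"
    have "continuous_on UNIV (cts_step x y)"
      by (rule uniformly_continuous_imp_continuous)
        (rule cts_step_uniformly_continuous[OF \<open>x < y\<close>])
    moreover have "bounded (range (cts_step x y))"
      using \<open>x < y\<close> by (intro boundedI[of _ 1]) (auto simp: cts_step_def divide_simps)
    ultimately show "(\<lambda>n. integral\<^sup>L (M n) (cts_step x y)) \<longlonglongrightarrow> integral\<^sup>L N (cts_step x y)"
      using * by (simp add: weakly_tendsto_def)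
  qed
next
  assume w: "weak_conv_m M N"
  show "weakly_tendsto M N sequentially"
    unfolding weakly_tendsto_def
  proof (intro allI impI)
    fix f :: "real \<Rightarrow> real" assume f: "continuous_on UNIV f \<and> bounded (range f)"
    then obtain B where B: "\<And>x. norm (f x) \<le> B" by (auto simp: bounded_iff)
    show "(\<lambda>n. \<integral>x. f x \<partial>M n) \<longlonglongrightarrow> (\<integral>x. f x \<partial>N)"
      by (rule weak_conv_imp_integral_bdd_continuous_conv[OF assms w _ B])
        (use f in \<open>auto simp: continuous_on_eq_continuous_at\<close>)
  qed
qed

end

theory Submission
  imports Defs "HOL-Real_Asymp.Real_Asymp"
begin

text \<open>Let \<open>\<sigma>\<^sub>k\<close> be the unfolded law at curvature \<open>k\<close>, divided by its section mass.
  The tail of \<open>\<mu>\<close> at \<open>r\<close> is the integral of a kernel \<open>Q\<^sub>k(R, r)\<close> against \<open>\<sigma>\<^sub>k(dR)\<close>, and \<open>Q\<^sub>k \<rightarrow> Q\<^sub>0\<close> uniformly for bounded \<open>R\<close>. Integrating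
  the tail of \<open>\<mu>\<close>, which does not depend on \<open>k\<close>, against a difference of two Abel kernels, which
  turns \<open>Q\<^sub>0\<close> into a clipped quadratic function of \<open>R\<close>, gives convergence of the integrals of these
  functions under \<open>\<sigma>\<^sub>k\<close>. No mass escapes: for large \<open>R\<close> one has \<open>Q\<^sub>k(R, 0) \<le> 6 Q\<^sub>k(R, r)\<close> whenever
  \<open>2r \<le> R\<close>; for small \<open>R\<close> the probability measure \<open>Q\<^sub>k(R, 0) \<sigma>\<^sub>k(dR)\<close> stochastically dominates \<open>\<mu>\<close>, so
  \<open>\<sigma>\<^sub>k((0, \<epsilon>])\<close> is at most the integral of \<open>1/r\<close> over \<open>(0, \<epsilon>]\<close> with respect to \<open>\<mu>\<close>, and \<open>1/r\<close> is
  \<open>\<mu>\<close>-integrable because \<open>0\<close> is admissible.\<close>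

section \<open>Cosines and hypotenuses in constant curvature\<close>

text \<open>The obstacle is radius 0. The tail identity at \<open>r = 0\<close> makes
  \<open>gcos_mass d k R\<close> a probability density with respect to \<sigma>_k, but this density
  is of order R near 0 and so does not bound \<sigma>_k there. Yet the total mass of \<sigma>_k, the
  reciprocal of the section mass, has to converge before the unfolded laws can be recovered by
  division. The constant 1 is not a clipped quadratic: \<open>ramp 0 y R / y\<^sup>2\<close> equals
  1 only for R \<ge> y, and the gap is paid for by the \<mu>-integral of 1/r over (0, y], which is
  the same for all curvatures. Integrability of 1/r comes from curvature 0: the s-integral of 2R -
  Q_0(R, 1/s) is bounded independently of R, and \<sigma>_0 is finite. A single Abel kernel tends to
  1 at infinity. In a difference of two the limits cancel, so the weight is integrable, and the
  resulting function of R is bounded. The factor 6 is dictated by negative curvature: [-R, R] is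
  covered by two translates of [-(R - r), R - r], and each translation costs a factor of at most e
  \<le> 3.\<close>

lemma le_max_radius_iff:
  assumes "k > 0"
  shows "ereal R \<le> max_radius k \<longleftrightarrow> sqrt k * R \<le> pi / 2"
  using assms by (simp add: max_radius_def field_simps)

lemma gcos_curvature_zero [simp]: "gcos 0 h = 1"
  by (simp add: gcos_def)

lemma gcos_at_zero [simp]: "gcos k 0 = 1"
  by (simp add: gcos_def)

lemma continuous_on_gcos [continuous_intros]: "continuous_on A (gcos k)"
  unfolding gcos_def by (cases "k > 0"; cases "k = 0") (auto intro!: continuous_intros)

lemma borel_measurable_gcos [measurable]: "gcos k \<in> borel_measurable borel"
  by (intro borel_measurable_continuous_onI continuous_intros)

lemma gcos_pos:
  assumes "0 \<le> r" "r < R" "ereal R \<le> max_radius k"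
  shows "0 < gcos k r"
proof (cases "k > 0")
  case True
  then have "sqrt k * R \<le> pi / 2" "sqrt k * r < sqrt k * R" "0 \<le> sqrt k * r"
    using assms by (auto simp: le_max_radius_iff)
  then have "- (pi / 2) < sqrt k * r" "sqrt k * r < pi / 2"
    using pi_gt_zero by linarith+
  then show ?thesis using True by (simp add: gcos_def cos_gt_zero_pi)
qed (auto simp: gcos_def cosh_real_pos)

lemma alpha_zero_right:
  assumes "0 \<le> R" "ereal R \<le> max_radius k"
  shows "alpha k R 0 = R"
proof -
  consider "k < 0" | "k = 0" | "k > 0" by linarith
  then show ?thesis
  proof cases
    case 1
    then show ?thesis using assms by (simp add: alpha_def arcosh_cosh_real)
  next
    case 2
    then show ?thesis using assms by (simp add: alpha_def)
  next
    case 3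
    then have "sqrt k * R \<le> pi / 2" "0 \<le> sqrt k * R"
      using assms by (auto simp: le_max_radius_iff)
    then have "sqrt k * R \<le> pi" "0 \<le> sqrt k * R"
      using pi_gt_zero by linarith+
    then show ?thesis using 3 by (simp add: alpha_def arccos_cos)
  qed
qed

text \<open>In a geodesic right triangle with hypotenuse \<open>R\<close> and leg \<open>r\<close>,
  the other leg is \<open>alpha k R r\<close>. The first claim is then Pythagoras' theorem in
  constant curvature and the last one the triangle inequality.\<close>

lemma
  assumes "0 \<le> r" "r < R" "ereal R \<le> max_radius k"
  shows gcos_alpha: "gcos k (alpha k R r) = gcos k R / gcos k r"
    and alpha_nonneg: "0 \<le> alpha k R r"
    and alpha_le: "alpha k R r \<le> R"
    and alpha_ge: "R - r \<le> alpha k R r"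
proof -
  consider "k < 0" | "k = 0" | "k > 0" by linarith
  then have "gcos k (alpha k R r) = gcos k R / gcos k r \<and> 0 \<le> alpha k R r \<and>
    alpha k R r \<le> R \<and> R - r \<le> alpha k R r"
  proof cases
    case 1
    define s where "s = sqrt (- k)"
    have s: "s > 0" using 1 by (simp add: s_def)
    define c where "c = cosh (s * R) / cosh (s * r)"
    have c1: "1 \<le> c"
      unfolding c_def using assms s by (simp add: cosh_real_nonneg_le_iff)
    have "c \<le> cosh (s * R)"
      unfolding c_def using cosh_real_ge_1[of "s * r"] cosh_real_ge_1[of "s * R"]
      by (simp add: divide_le_eq mult_le_cancel_left1)
    then have "cosh (arcosh c) \<le> cosh (s * R)" using c1 by simp
    then have le: "arcosh c \<le> s * R"
      using c1 s assms by (subst (asm) cosh_real_nonneg_le_iff) auto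
    \<comment> \<open>The triangle inequality comes from the addition theorem once the nonnegative
      product of hyperbolic sines is dropped.\<close>
    have "cosh (s * R) = cosh (s * (R - r)) * cosh (s * r) + sinh (s * (R - r)) * sinh (s * r)"
      by (simp add: cosh_add[symmetric] algebra_simps)
    moreover have "0 \<le> sinh (s * (R - r)) * sinh (s * r)"
      using s assms by simp
    ultimately have "cosh (s * (R - r)) \<le> c"
      unfolding c_def by (simp add: pos_le_divide_eq cosh_real_pos)
    then have "cosh (s * (R - r)) \<le> cosh (arcosh c)" using c1 by simp
    then have ge: "s * (R - r) \<le> arcosh c"
      using c1 s assms by (subst (asm) cosh_real_nonneg_le_iff) auto
    have al: "alpha k R r = arcosh c / s"
      using 1 by (simp add: alpha_def c_def s_def)
    have g: "gcos k h = cosh (s * h)" for h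
      using 1 by (simp add: gcos_def s_def)
    show ?thesis
      unfolding al g using le ge c1 s by (simp add: c_def field_simps)
  next
    case 2
    have "sqrt (R\<^sup>2 - r\<^sup>2) \<le> sqrt (R\<^sup>2)" by (rule real_sqrt_le_mono) simp
    moreover have "R - r \<le> sqrt (R\<^sup>2 - r\<^sup>2)"
    proof (rule real_le_rsqrt)
      have "r * r \<le> R * r" using assms by (intro mult_right_mono) auto
      then show "(R - r)\<^sup>2 \<le> R\<^sup>2 - r\<^sup>2" by (simp add: power2_eq_square algebra_simps)
    qed
    moreover have "r\<^sup>2 \<le> R\<^sup>2" using assms by (intro power_mono) auto
    ultimately show ?thesis using 2 assms by (simp add: alpha_def)
  next
    case 3
    define s where "s = sqrt k"
    have s: "s > 0" using 3 by (simp add: s_def)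
    have sR: "s * R \<le> pi / 2" using assms 3 by (simp add: le_max_radius_iff s_def)
    have sr: "s * r < s * R" "0 \<le> s * r" "0 < s * R" using s assms by auto
    define c where "c = cos (s * R) / cos (s * r)"
    have cr: "0 < cos (s * r)" using sR sr by (intro cos_gt_zero_pi) auto
    have cR: "0 \<le> cos (s * R)" using sR sr by (intro cos_ge_zero) auto
    have c0: "0 \<le> c" using cr cR by (simp add: c_def)
    have "cos (s * R) \<le> cos (s * r)" using sR sr by (intro cos_monotone_0_pi_le) auto
    then have c1: "c \<le> 1" using cr by (simp add: c_def)
    have "cos (s * R) \<le> c"
      unfolding c_def using cr cR by (simp add: pos_le_divide_eq mult_le_cancel_left1)
        (metis cos_le_one mult.commute mult_left_le)
    then have "arccos c \<le> arccos (cos (s * R))"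
      using c0 c1 cR by (intro arccos_le_arccos) auto
    then have le: "arccos c \<le> s * R" using sR sr by (simp add: arccos_cos)
    \<comment> \<open>Spherical triangle inequality: the product
      \<open>cos (s * (R - r)) * cos (s * r)\<close> is the mean of the cosines of
      \<open>s * R - 2 * (s * r)\<close> and \<open>s * R\<close>, and the first angle is no larger
      in modulus than the second.\<close>
    have "cos (s * R) \<le> cos \<bar>s * R - 2 * (s * r)\<bar>"
      using sR sr by (intro cos_monotone_0_pi_le) auto
    then have "cos (s * R) \<le> (cos (s * R - 2 * (s * r)) + cos (s * R)) / 2"
      by (simp only: cos_abs_real) simp
    also have "\<dots> = cos (s * (R - r)) * cos (s * r)"
      by (simp add: cos_times_cos right_diff_distrib mult.commute[of r s])
    finally have "cos (s * R) \<le> cos (s * (R - r)) * cos (s * r)" .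
    then have "c \<le> cos (s * (R - r))"
      unfolding c_def using cr by (simp add: divide_le_eq)
    then have "arccos (cos (s * (R - r))) \<le> arccos c"
      using c0 by (intro arccos_le_arccos) auto
    moreover have "0 \<le> s * (R - r)" "s * (R - r) \<le> pi"
      using sR sr by (auto simp: algebra_simps)
    ultimately have ge: "s * (R - r) \<le> arccos c" by (simp add: arccos_cos)
    have al: "alpha k R r = arccos c / s"
      using 3 by (simp add: alpha_def c_def s_def)
    have g: "gcos k h = cos (s * h)" for h
      using 3 by (simp add: gcos_def s_def)
    have "cos (arccos c) = c" "0 \<le> arccos c" using c0 c1 by (auto intro: arccos_lbound)
    then show ?thesis
      unfolding al g using le ge s by (simp add: c_def field_simps)
  qed
  then show "gcos k (alpha k R r) = gcos k R / gcos k r" "0 \<le> alpha k R r"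
    "alpha k R r \<le> R" "R - r \<le> alpha k R r" by auto
qed

text \<open>Dividing by the signed \<open>k\<close> gives cosine and hyperbolic cosine the same
  leading term, and both depend only on \<open>sqrt \<bar>k\<bar> * \<bar>h\<bar>\<close>. A bound
  on \<open>\<bar>k\<bar> * h\<^sup>2\<close> therefore makes the expansion uniform in
  \<open>k\<close> and \<open>h\<close> together.\<close>

lemma gcos_quadratic_expansion:
  assumes "\<eta> > 0"
  obtains \<delta> where "\<delta> > 0"
    "\<And>k h. k \<noteq> 0 \<Longrightarrow> \<bar>k\<bar> * h\<^sup>2 < \<delta> \<Longrightarrow> \<bar>(1 - gcos k h) / k - h\<^sup>2 / 2\<bar> \<le> \<eta> * h\<^sup>2"
proof -
  have "((\<lambda>x::real. (1 - cos x) / x\<^sup>2) \<longlongrightarrow> 1 / 2) (at_right 0)" by real_asymp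
  then have 1: "eventually (\<lambda>x::real. \<bar>(1 - cos x) / x\<^sup>2 - 1 / 2\<bar> < \<eta>) (at_right 0)"
    using assms by (auto simp: tendsto_iff dist_real_def)
  have "((\<lambda>x::real. (cosh x - 1) / x\<^sup>2) \<longlongrightarrow> 1 / 2) (at_right 0)" by real_asymp
  then have 2: "eventually (\<lambda>x::real. \<bar>(cosh x - 1) / x\<^sup>2 - 1 / 2\<bar> < \<eta>) (at_right 0)"
    using assms by (auto simp: tendsto_iff dist_real_def)
  from eventually_conj[OF 1 2] obtain e where e: "e > 0"
    and 1: "\<And>x. 0 < x \<Longrightarrow> x < e \<Longrightarrow> \<bar>(1 - cos x) / x\<^sup>2 - 1 / 2\<bar> < \<eta>"
    and 2: "\<And>x. 0 < x \<Longrightarrow> x < e \<Longrightarrow> \<bar>(cosh x - 1) / x\<^sup>2 - 1 / 2\<bar> < \<eta>"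
    by (auto simp: eventually_at_right_field)
  show thesis
  proof (rule that[of "e\<^sup>2"])
    show "e\<^sup>2 > 0" using e by simp
    fix k h :: real assume k: "k \<noteq> 0" and kh: "\<bar>k\<bar> * h\<^sup>2 < e\<^sup>2"
    show "\<bar>(1 - gcos k h) / k - h\<^sup>2 / 2\<bar> \<le> \<eta> * h\<^sup>2"
    proof (cases "h = 0")
      case False
      define x where "x = sqrt \<bar>k\<bar> * \<bar>h\<bar>"
      have x: "0 < x" using k False by (simp add: x_def)
      have x2: "x\<^sup>2 = \<bar>k\<bar> * h\<^sup>2" by (simp add: x_def power_mult_distrib)
      have xe: "x < e" using kh x2 e x by (intro power_less_imp_less_base[of x 2 e]) auto
      have "(1 - gcos k h) / k - h\<^sup>2 / 2 = h\<^sup>2 * ((1 - gcos k h) / (k * h\<^sup>2) - 1 / 2)"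
        using False k by (simp add: field_simps)
      then have "\<bar>(1 - gcos k h) / k - h\<^sup>2 / 2\<bar> = h\<^sup>2 * \<bar>(1 - gcos k h) / (k * h\<^sup>2) - 1 / 2\<bar>"
        by (simp only: abs_mult abs_power2)
      also have "\<bar>(1 - gcos k h) / (k * h\<^sup>2) - 1 / 2\<bar> < \<eta>"
      proof (cases "k > 0")
        case True
        have "gcos k h = cos x"
          using True by (cases "h \<ge> 0") (auto simp: gcos_def x_def)
        then show ?thesis using 1[OF x xe] x2 True by simp
      next
        case F: False
        have "gcos k h = cosh x"
          using F k by (cases "h \<ge> 0") (auto simp: gcos_def x_def)
        moreover have "k * h\<^sup>2 = - x\<^sup>2" using x2 F k by simp
        moreover have "(1 - cosh x) / (- x\<^sup>2) = (cosh x - 1) / x\<^sup>2"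
          by (metis minus_diff_eq minus_divide_divide)
        ultimately show ?thesis using 2[OF x xe] by simp
      qed
      finally show ?thesis using False by (simp add: mult.commute)
    qed simp
  qed
qed

lemma gcos_near_one:
  assumes "\<eta> > 0" "b > 0"
  obtains \<delta> where "\<delta> > 0" "\<And>k h. \<bar>k\<bar> < \<delta> \<Longrightarrow> \<bar>h\<bar> \<le> b \<Longrightarrow> \<bar>gcos k h - 1\<bar> \<le> \<eta>"
proof -
  obtain \<delta> where \<delta>: "\<delta> > 0" and *:
    "\<And>k h. k \<noteq> 0 \<Longrightarrow> \<bar>k\<bar> * h\<^sup>2 < \<delta> \<Longrightarrow> \<bar>(1 - gcos k h) / k - h\<^sup>2 / 2\<bar> \<le> 1 / 2 * h\<^sup>2"
    using gcos_quadratic_expansion[of "1/2"] by auto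
  show thesis
  proof (rule that[of "min \<delta> \<eta> / b\<^sup>2"])
    show "min \<delta> \<eta> / b\<^sup>2 > 0" using \<delta> assms by simp
    fix k h :: real assume k: "\<bar>k\<bar> < min \<delta> \<eta> / b\<^sup>2" and h: "\<bar>h\<bar> \<le> b"
    have h2: "h\<^sup>2 \<le> b\<^sup>2" using h by (rule abs_le_square_iff[THEN iffD1, OF order.trans]) auto
    have kb: "\<bar>k\<bar> * b\<^sup>2 < min \<delta> \<eta>" using k assms by (simp add: pos_less_divide_eq)
    have kh: "\<bar>k\<bar> * h\<^sup>2 < min \<delta> \<eta>"
      using mult_left_mono[OF h2, of "\<bar>k\<bar>"] kb by linarith
    show "\<bar>gcos k h - 1\<bar> \<le> \<eta>"
    proof (cases "k = 0")
      case False
      then have "\<bar>(1 - gcos k h) / k\<bar> \<le> h\<^sup>2"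
        using *[of k h] kh by linarith
      then have "\<bar>1 - gcos k h\<bar> \<le> h\<^sup>2 * \<bar>k\<bar>"
        using False by (simp add: divide_le_eq)
      then show ?thesis using kh by (simp add: abs_minus_commute mult.commute)
    qed (use assms in simp)
  qed
qed

lemma gcos_power_near_one:
  assumes "\<eta> > 0" "b > 0"
  obtains \<delta> where "\<delta> > 0" "\<And>k h. \<bar>k\<bar> < \<delta> \<Longrightarrow> \<bar>h\<bar> \<le> b \<Longrightarrow> \<bar>gcos k h ^ n - 1\<bar> \<le> \<eta>"
proof -
  have "isCont (\<lambda>x::real. x ^ n) 1" by simp
  then obtain e where e: "e > 0" "\<And>x::real. \<bar>x - 1\<bar> < e \<Longrightarrow> \<bar>x ^ n - 1\<bar> < \<eta>"
    using assms unfolding continuous_at_eps_delta by (auto simp: dist_real_def)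
  obtain \<delta> where \<delta>: "\<delta> > 0" "\<And>k h. \<bar>k\<bar> < \<delta> \<Longrightarrow> \<bar>h\<bar> \<le> b \<Longrightarrow> \<bar>gcos k h - 1\<bar> \<le> e / 2"
    using gcos_near_one[of "e / 2" b] e assms by auto
  show thesis
  proof (rule that[OF \<delta>(1)])
    fix k h :: real assume "\<bar>k\<bar> < \<delta>" "\<bar>h\<bar> \<le> b"
    then have "\<bar>gcos k h - 1\<bar> < e" using \<delta>(2)[of k h] e(1) by simp
    then show "\<bar>gcos k h ^ n - 1\<bar> \<le> \<eta>" using e(2) by (simp add: less_imp_le)
  qed
qed

lemma le_max_radius_small_curvature:
  assumes "b > 0"
  obtains \<delta> where "\<delta> > 0" "\<And>k R. \<bar>k\<bar> < \<delta> \<Longrightarrow> R \<le> b \<Longrightarrow> ereal R \<le> max_radius k"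
proof (rule that[of "(pi / 2 / b)\<^sup>2"])
  show "(pi / 2 / b)\<^sup>2 > 0" using assms by simp
  fix k R assume k: "\<bar>k\<bar> < (pi / 2 / b)\<^sup>2" and R: "R \<le> b"
  show "ereal R \<le> max_radius k"
  proof (cases "k > 0")
    case True
    have "sqrt k < pi / 2 / b" using k True assms by (intro real_less_lsqrt) auto
    then have "sqrt k * b \<le> pi / 2" using assms by (simp add: field_simps)
    moreover have "sqrt k * R \<le> sqrt k * b" using R True by simp
    ultimately have "sqrt k * R \<le> pi / 2" by linarith
    then show ?thesis using True by (simp add: le_max_radius_iff)
  qed (simp add: max_radius_def)
qed

section \<open>Masses of symmetric intervals and the section kernel\<close>

definition gcos_mass :: "nat \<Rightarrow> real \<Rightarrow> real \<Rightarrow> real" where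
  "gcos_mass d k a = enn2real (gcos_integral d k a)"

lemma gcos_integral_finite: "gcos_integral d k a < \<infinity>"
proof -
  have "compact ((\<lambda>h. gcos k h ^ (d - 1)) ` {- a..a})"
    by (intro compact_continuous_image continuous_intros) auto
  then obtain B where B: "\<And>h. h \<in> {- a..a} \<Longrightarrow> \<bar>gcos k h ^ (d - 1)\<bar> \<le> B"
    by (metis (no_types, lifting) bounded_iff compact_imp_bounded imageI real_norm_def)
  have "gcos_integral d k a \<le> (\<integral>\<^sup>+h. ennreal B * indicator {- a..a} h \<partial>lborel)"
    unfolding gcos_integral_def using B
    by (intro nn_integral_mono) (force intro!: ennreal_leI split: split_indicator)
  also have "\<dots> < \<infinity>"
    by (subst nn_integral_cmult_indicator) (auto simp: ennreal_mult_less_top emeasure_lborel_Icc_eq)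
  finally show ?thesis .
qed

lemma ennreal_gcos_mass: "ennreal (gcos_mass d k a) = gcos_integral d k a"
  unfolding gcos_mass_def using gcos_integral_finite by simp

lemma gcos_mass_nonneg [simp]: "0 \<le> gcos_mass d k a"
  by (simp add: gcos_mass_def)

lemma gcos_mass_mono: "a \<le> b \<Longrightarrow> gcos_mass d k a \<le> gcos_mass d k b"
  unfolding gcos_mass_def using gcos_integral_finite[of d k b]
  by (intro enn2real_mono)
     (auto simp: gcos_integral_def intro!: nn_integral_mono split: split_indicator)

lemma borel_measurable_gcos_mass [measurable]: "gcos_mass d k \<in> borel_measurable borel"
  by (rule borel_measurable_mono) (auto intro!: monoI gcos_mass_mono)

lemma gcos_mass_le:
  assumes "0 \<le> a" "\<And>h. \<bar>h\<bar> \<le> a \<Longrightarrow> gcos k h ^ (d - 1) \<le> u" "0 \<le> u"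
  shows "gcos_mass d k a \<le> 2 * a * u"
proof -
  have "gcos_integral d k a \<le> (\<integral>\<^sup>+h. ennreal u * indicator {- a..a} h \<partial>lborel)"
    unfolding gcos_integral_def using assms
    by (intro nn_integral_mono) (auto intro!: ennreal_leI split: split_indicator)
  also have "\<dots> = ennreal (2 * a * u)"
    using assms by (subst nn_integral_cmult_indicator) (auto simp: ennreal_mult' mult.commute)
  finally show ?thesis using assms by (simp add: ennreal_gcos_mass[symmetric])
qed

lemma gcos_mass_ge:
  assumes "0 \<le> a" "\<And>h. \<bar>h\<bar> \<le> a \<Longrightarrow> l \<le> gcos k h ^ (d - 1)"
  shows "2 * a * l \<le> gcos_mass d k a"
proof (cases "0 \<le> l")
  case True
  have "ennreal (2 * a * l) = (\<integral>\<^sup>+h. ennreal l * indicator {- a..a} h \<partial>lborel)"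
    using assms True by (subst nn_integral_cmult_indicator) (auto simp: ennreal_mult' mult.commute)
  also have "\<dots> \<le> gcos_integral d k a"
    unfolding gcos_integral_def using assms
    by (intro nn_integral_mono) (auto intro!: ennreal_leI split: split_indicator)
  finally show ?thesis by (simp add: ennreal_gcos_mass[symmetric])
next
  case False
  then have "2 * a * l \<le> 0" using assms by (simp add: mult_nonneg_nonpos)
  then show ?thesis using gcos_mass_nonneg[of d k a] by linarith
qed

lemma gcos_mass_curvature_zero [simp]: "0 \<le> a \<Longrightarrow> gcos_mass d 0 a = 2 * a"
  using gcos_mass_le[of a 0 d 1] gcos_mass_ge[of a 1 0 d] by simp

text \<open>Truncating to the admissible range of radii makes the measurability and the bounds below
  unconditional.\<close>

definition section_kernel :: "nat \<Rightarrow> real \<Rightarrow> real \<Rightarrow> real \<Rightarrow> real" where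
  "section_kernel d k R r =
     (if 0 \<le> r \<and> r < R \<and> ereal R \<le> max_radius k then gcos_mass d k (alpha k R r) else 0)"

lemma section_kernel_nonneg [simp]: "0 \<le> section_kernel d k R r"
  by (simp add: section_kernel_def)

lemma section_kernel_le: "section_kernel d k R r \<le> gcos_mass d k R"
  by (auto simp: section_kernel_def intro!: gcos_mass_mono alpha_le)

lemma section_kernel_zero_right:
  "0 < R \<Longrightarrow> ereal R \<le> max_radius k \<Longrightarrow> section_kernel d k R 0 = gcos_mass d k R"
  by (simp add: section_kernel_def alpha_zero_right)

lemma section_kernel_curvature_zero:
  "section_kernel d 0 R r = (if 0 \<le> r \<and> r < R then 2 * sqrt (R\<^sup>2 - r\<^sup>2) else 0)"
proof (cases "0 \<le> r \<and> r < R")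
  case True
  then have "r\<^sup>2 \<le> R\<^sup>2" by (intro power_mono) auto
  with True show ?thesis by (simp add: section_kernel_def alpha_def max_radius_def)
qed (auto simp: section_kernel_def)

lemma borel_measurable_section_kernel [measurable]:
  assumes [measurable]: "f \<in> borel_measurable M" "g \<in> borel_measurable M"
  shows "(\<lambda>x. section_kernel d k (f x) (g x)) \<in> borel_measurable M"
proof -
  consider "k < 0" | "k = 0" | "k > 0" by linarith
  then show ?thesis
  proof cases
    case 1
    have [measurable]: "cosh \<in> borel_measurable (borel :: real measure)"
      by (intro borel_measurable_continuous_onI continuous_intros)
    define ac :: "real \<Rightarrow> real" where "ac y = arcosh y" for y
    have [measurable]: "ac \<in> borel_measurable borel"
      unfolding ac_def arcosh_def by measurable
    have *: "section_kernel d k R r =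
      (if 0 \<le> r \<and> r < R \<and> ereal R \<le> max_radius k
       then gcos_mass d k (ac (cosh (sqrt (- k) * R) / cosh (sqrt (- k) * r)) / sqrt (- k)) else 0)" for R r
      using 1 by (simp add: section_kernel_def alpha_def ac_def)
    show ?thesis unfolding * by measurable
  next
    case 2
    show ?thesis unfolding 2 section_kernel_curvature_zero by measurable
  next
    case 3
    \<comment> \<open>Clamping the argument makes the arccosine continuous on the whole line. For
      admissible radii the quotient of cosines lies between 0 and 1, so no value changes.\<close>
    define ac :: "real \<Rightarrow> real" where "ac y = arccos (max (- 1) (min 1 y))" for y
    have [measurable]: "ac \<in> borel_measurable borel"
      unfolding ac_def by (intro borel_measurable_continuous_onI continuous_intros) auto
    have *: "section_kernel d k R r =
      (if 0 \<le> r \<and> r < R \<and> ereal R \<le> max_radius k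
       then gcos_mass d k (ac (cos (sqrt k * R) / cos (sqrt k * r)) / sqrt k) else 0)" for R r
    proof (cases "0 \<le> r \<and> r < R \<and> ereal R \<le> max_radius k")
      case True
      then have R: "sqrt k * R \<le> pi / 2" "sqrt k * r < sqrt k * R" "0 \<le> sqrt k * r"
        using 3 by (auto simp: le_max_radius_iff)
      have "cos (sqrt k * R) \<le> cos (sqrt k * r)" using R by (intro cos_monotone_0_pi_le) auto
      moreover have "0 < cos (sqrt k * r)" using R by (intro cos_gt_zero_pi) auto
      moreover have "0 \<le> cos (sqrt k * R)" using R by (intro cos_ge_zero) auto
      ultimately have c: "cos (sqrt k * R) / cos (sqrt k * r) \<le> 1"
        "0 \<le> cos (sqrt k * R) / cos (sqrt k * r)" by auto
      show ?thesis
        using True 3 c by (simp add: section_kernel_def alpha_def ac_def)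
    qed (auto simp: section_kernel_def)
    show ?thesis unfolding * by measurable
  qed
qed

text \<open>In terms of \<open>v h = (1 - gcos k h) / k\<close>, Pythagoras' theorem reads
  \<open>v a * gcos k r = v R - v r\<close>. As \<open>v h\<close> is close to
  \<open>h\<^sup>2 / 2\<close> and \<open>gcos k r\<close> to 1, this is nearly the Euclidean
  relation between the squares. Half of \<eta> pays for the difference of the two legs, the other
  half for replacing the integrand by 1.\<close>

lemma section_kernel_uniform_limit:
  assumes "\<eta> > 0" "b > 0"
  obtains \<delta> where "\<delta> > 0"
    "\<And>k R r. \<bar>k\<bar> < \<delta> \<Longrightarrow> R \<le> b \<Longrightarrow> \<bar>section_kernel d k R r - section_kernel d 0 R r\<bar> \<le> \<eta>"
proof -
  \<comment> \<open>Replacing \<open>v\<close> by half the square at \<open>a\<close>,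
    \<open>R\<close> and \<open>r\<close>, and \<open>gcos k r\<close> by 1, makes four errors of
    size \<open>\<theta> * b\<^sup>2\<close>, hence 8 of them in \<open>a\<^sup>2\<close>. The
    square root is only Hoelder continuous at 0, so \<theta> has to be quadratic in \<eta>. The cap
    1/2 yields \<open>\<bar>v a\<bar> \<le> b\<^sup>2\<close>.\<close>
  define \<theta> where "\<theta> = min (1 / 2) ((\<eta> / (4 * b))\<^sup>2 / 8)"
  have \<theta>: "\<theta> > 0" "\<theta> \<le> 1 / 2" "8 * \<theta> \<le> (\<eta> / (4 * b))\<^sup>2"
    using assms by (auto simp: \<theta>_def min_def)
  obtain \<delta>1 where \<delta>1: "\<delta>1 > 0" and V:
    "\<And>k h. k \<noteq> 0 \<Longrightarrow> \<bar>k\<bar> * h\<^sup>2 < \<delta>1 \<Longrightarrow> \<bar>(1 - gcos k h) / k - h\<^sup>2 / 2\<bar> \<le> \<theta> * h\<^sup>2"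
    using gcos_quadratic_expansion[OF \<theta>(1)] by blast
  obtain \<delta>2 where \<delta>2: "\<delta>2 > 0" and g: "\<And>k h. \<bar>k\<bar> < \<delta>2 \<Longrightarrow> \<bar>h\<bar> \<le> b \<Longrightarrow> \<bar>gcos k h - 1\<bar> \<le> \<theta>"
    using gcos_near_one[OF \<theta>(1) assms(2)] by blast
  have "\<eta> / (4 * b) > 0" using assms by simp
  then obtain \<delta>3 where \<delta>3: "\<delta>3 > 0" and gd:
    "\<And>k h. \<bar>k\<bar> < \<delta>3 \<Longrightarrow> \<bar>h\<bar> \<le> b \<Longrightarrow> \<bar>gcos k h ^ (d - 1) - 1\<bar> \<le> \<eta> / (4 * b)"
    using gcos_power_near_one[of "\<eta> / (4 * b)" b "d - 1"] assms(2) by blast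
  obtain \<delta>4 where \<delta>4: "\<delta>4 > 0" and mr: "\<And>k R. \<bar>k\<bar> < \<delta>4 \<Longrightarrow> R \<le> b \<Longrightarrow> ereal R \<le> max_radius k"
    using le_max_radius_small_curvature[OF assms(2)] by blast
  show thesis
  proof (rule that[of "min (min (\<delta>1 / b\<^sup>2) \<delta>2) (min \<delta>3 \<delta>4)"])
    show "min (min (\<delta>1 / b\<^sup>2) \<delta>2) (min \<delta>3 \<delta>4) > 0"
      using \<delta>1 \<delta>2 \<delta>3 \<delta>4 assms by simp
    fix k R r assume k: "\<bar>k\<bar> < min (min (\<delta>1 / b\<^sup>2) \<delta>2) (min \<delta>3 \<delta>4)" and R: "R \<le> b"
    show "\<bar>section_kernel d k R r - section_kernel d 0 R r\<bar> \<le> \<eta>"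
    proof (cases "k \<noteq> 0 \<and> 0 \<le> r \<and> r < R")
      case True
      define a where "a = alpha k R r"
      have mR: "ereal R \<le> max_radius k" using mr k R by auto
      note al = gcos_alpha[of r R k] alpha_nonneg[of r R k] alpha_le[of r R k]
      have a: "gcos k a = gcos k R / gcos k r" "0 \<le> a" "a \<le> R"
        using al True mR by (auto simp: a_def)
      have kb: "\<bar>k\<bar> * b\<^sup>2 < \<delta>1" using k assms by (simp add: pos_less_divide_eq)
      have sq: "h\<^sup>2 \<le> b\<^sup>2" if "\<bar>h\<bar> \<le> b" for h
        using that power_mono[OF that, of 2] by simp
      have kh: "\<bar>k\<bar> * h\<^sup>2 < \<delta>1" if "\<bar>h\<bar> \<le> b" for h
        using mult_left_mono[OF sq[OF that], of "\<bar>k\<bar>"] kb by linarith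
      define v where "v h = (1 - gcos k h) / k" for h
      have v: "\<bar>v h - h\<^sup>2 / 2\<bar> \<le> \<theta> * b\<^sup>2" if "\<bar>h\<bar> \<le> b" for h
        using V[OF _ kh[OF that]] True mult_left_mono[OF sq[OF that], of \<theta>] \<theta>
        unfolding v_def by (meson less_imp_le order.trans)
      have ranges: "\<bar>a\<bar> \<le> b" "\<bar>R\<bar> \<le> b" "\<bar>r\<bar> \<le> b" using a True R by auto
      have gr: "0 < gcos k r" using gcos_pos True mR by blast
      have va: "v a * gcos k r = v R - v r"
        using gr True by (simp add: v_def a field_simps)
      have "\<bar>v a\<bar> \<le> b\<^sup>2"
      proof -
        have "\<theta> * b\<^sup>2 \<le> 1 / 2 * b\<^sup>2" using \<theta> by (intro mult_right_mono) auto
        then show ?thesis using v[OF ranges(1)] sq[OF ranges(1)] zero_le_power2[of a] unfolding abs_le_iff by linarith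
      qed
      then have "\<bar>v a * (1 - gcos k r)\<bar> \<le> b\<^sup>2 * \<theta>"
        using g[of k r] k ranges by (subst abs_mult, intro mult_mono) auto
      then have "\<bar>v a - (v R - v r)\<bar> \<le> \<theta> * b\<^sup>2"
        using va by (simp add: algebra_simps)
      then have "\<bar>a\<^sup>2 - (R\<^sup>2 - r\<^sup>2)\<bar> \<le> 8 * (\<theta> * b\<^sup>2)"
        using v[OF ranges(1)] v[OF ranges(2)] v[OF ranges(3)] by linarith
      also have "\<dots> \<le> (\<eta> / (4 * b))\<^sup>2 * b\<^sup>2"
        using mult_right_mono[OF \<theta>(3), of "b\<^sup>2"] by simp
      also have "\<dots> = (\<eta> / 4)\<^sup>2" using assms by (simp add: power2_eq_square)
      finally have a2: "\<bar>a\<^sup>2 - (R\<^sup>2 - r\<^sup>2)\<bar> \<le> (\<eta> / 4)\<^sup>2" .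
      define c where "c = sqrt (R\<^sup>2 - r\<^sup>2)"
      have "r\<^sup>2 \<le> R\<^sup>2" using True by (intro power_mono) auto
      then have c: "0 \<le> c" "c\<^sup>2 = R\<^sup>2 - r\<^sup>2" by (auto simp: c_def)
      \<comment> \<open>Since \<open>a\<close> and \<open>c\<close> are nonnegative, their distance
        is at most their sum. This bounds the distance without dividing by the sum, which may be
        arbitrarily small.\<close>
      have "(a - c)\<^sup>2 = \<bar>a - c\<bar> * \<bar>a - c\<bar>" by (simp add: power2_eq_square)
      also have "\<dots> \<le> \<bar>a - c\<bar> * \<bar>a + c\<bar>" using a c by (intro mult_left_mono) auto
      also have "\<dots> = \<bar>a\<^sup>2 - c\<^sup>2\<bar>"
        by (simp add: abs_mult[symmetric] power2_eq_square algebra_simps)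
      finally have "(a - c)\<^sup>2 \<le> (\<eta> / 4)\<^sup>2" using a2 c by simp
      then have ac: "\<bar>a - c\<bar> \<le> \<eta> / 4" using assms by (simp add: abs_le_square_iff[symmetric])
      have gb: "\<bar>gcos k h ^ (d - 1) - 1\<bar> \<le> \<eta> / (4 * b)" if "\<bar>h\<bar> \<le> a" for h
        using gd[of k h] that k a R by auto
      have "gcos_mass d k a \<le> 2 * a * (1 + \<eta> / (4 * b))"
        using gb a assms by (intro gcos_mass_le) (force simp: abs_le_iff)+
      moreover have "2 * a * (1 - \<eta> / (4 * b)) \<le> gcos_mass d k a"
        using gb a by (intro gcos_mass_ge) (force simp: abs_le_iff)+
      moreover have "2 * a * (\<eta> / (4 * b)) \<le> \<eta> / 2"
        using mult_right_mono[of a b "\<eta> / (2 * b)"] a R assms by (simp add: mult.commute)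
      ultimately have "\<bar>gcos_mass d k a - 2 * a\<bar> \<le> \<eta> / 2"
        unfolding abs_le_iff distrib_left right_diff_distrib by linarith
      with ac have "\<bar>gcos_mass d k a - 2 * c\<bar> \<le> \<eta>" by linarith
      moreover have "section_kernel d k R r = gcos_mass d k a"
        using True mR by (simp add: section_kernel_def a_def)
      moreover have "section_kernel d 0 R r = 2 * c"
        using True by (simp add: section_kernel_curvature_zero c_def)
      ultimately show ?thesis by simp
    qed (use assms in \<open>auto simp: section_kernel_def\<close>)
  qed
qed

section \<open>Lower bounds that prevent loss of mass\<close>

text \<open>The integrand is at least 1/2 on bounded intervals only, hence the truncation at
  \<open>b\<close>; beyond it monotonicity takes over. For small radii this dominates
  \<open>R\<close> itself, and for \<open>b \<ge> 1\<close> and radii above \<open>b\<close> it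
  dominates 1.\<close>

lemma gcos_mass_ge_min:
  assumes "b > 0"
  obtains \<delta> where "\<delta> > 0" "\<And>k R. \<bar>k\<bar> < \<delta> \<Longrightarrow> 0 \<le> R \<Longrightarrow> min R b \<le> gcos_mass d k R"
proof -
  obtain \<delta> where \<delta>: "\<delta> > 0" and g:
    "\<And>k h. \<bar>k\<bar> < \<delta> \<Longrightarrow> \<bar>h\<bar> \<le> b \<Longrightarrow> \<bar>gcos k h ^ (d - 1) - 1\<bar> \<le> 1 / 2"
    using gcos_power_near_one[of "1 / 2" b "d - 1"] assms by auto
  show thesis
  proof (rule that[OF \<delta>])
    fix k R :: real assume k: "\<bar>k\<bar> < \<delta>" and R: "0 \<le> R"
    have "2 * min R b * (1 / 2) \<le> gcos_mass d k (min R b)"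
    proof (rule gcos_mass_ge)
      fix h assume "\<bar>h\<bar> \<le> min R b"
      then have "\<bar>h\<bar> \<le> b" by simp
      from g[OF k this] show "1 / 2 \<le> gcos k h ^ (d - 1)" unfolding abs_le_iff by linarith
    qed (use R assms in auto)
    also have "\<dots> \<le> gcos_mass d k R" by (rule gcos_mass_mono) simp
    finally show "min R b \<le> gcos_mass d k R" by simp
  qed
qed

text \<open>In nonnegative curvature \<open>gcos k\<close> does not increase with
  \<open>\<bar>h\<bar>\<close> on the admissible range, so it can only grow when \<open>h\<close> is
  halved. The substitution contributes the factor 2.\<close>

lemma gcos_integral_halve:
  assumes "0 \<le> k" "ereal R \<le> max_radius k"
  shows "gcos_integral d k R \<le> 2 * gcos_integral d k (R / 2)"
proof -
  have "gcos_integral d k R \<le> (\<integral>\<^sup>+h\<in>{- R..R}. ennreal (gcos k (h / 2) ^ (d - 1)) \<partial>lborel)"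
    unfolding gcos_integral_def
  proof (rule nn_integral_mono)
    fix h :: real
    show "ennreal (gcos k h ^ (d - 1)) * indicator {- R..R} h \<le>
      ennreal (gcos k (h / 2) ^ (d - 1)) * indicator {- R..R} h"
    proof (cases "h \<in> {- R..R} \<and> k \<noteq> 0")
      case True
      then have k: "k > 0" using assms by simp
      have "sqrt k * \<bar>h\<bar> \<le> sqrt k * R" using True k by (intro mult_left_mono) auto
      also have "\<dots> \<le> pi / 2" using assms k by (simp add: le_max_radius_iff)
      finally have h: "sqrt k * \<bar>h\<bar> \<le> pi / 2" .
      then have h': "sqrt k * \<bar>h\<bar> \<le> pi" using pi_gt_zero by linarith
      have c: "gcos k x = cos (sqrt k * \<bar>x\<bar>)" for x
        using k by (cases "x \<ge> 0") (auto simp: gcos_def)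
      have "cos (sqrt k * \<bar>h\<bar>) \<le> cos (sqrt k * \<bar>h / 2\<bar>)"
        using h h' k by (intro cos_monotone_0_pi_le) auto
      moreover have "0 \<le> cos (sqrt k * \<bar>h\<bar>)"
        using h k pi_gt_zero by (intro cos_ge_zero) (auto intro: order.trans[of _ 0])
      ultimately show ?thesis unfolding c using True
        by (auto intro!: ennreal_leI power_mono)
    qed auto
  qed
  also have "\<dots> = 2 * (ennreal (1 / 2) *
      (\<integral>\<^sup>+h. ennreal (gcos k (0 + 1 / 2 * h) ^ (d - 1)) * indicator {- (R / 2)..R / 2} (0 + 1 / 2 * h) \<partial>lborel))"
  proof -
    have "ennreal 2 * ennreal (1 / 2) = 1" by (subst ennreal_mult[symmetric]) simp_all
    then have "2 * ennreal (1 / 2) = 1" by (simp only: ennreal_numeral)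
    then show ?thesis
      by (auto simp flip: mult.assoc intro!: nn_integral_cong split: split_indicator)
  qed
  also have "\<dots> = 2 * gcos_integral d k (R / 2)"
    unfolding gcos_integral_def
    by (subst (2) nn_integral_real_affine[where c = "1 / 2" and t = 0]) auto
  finally show ?thesis .
qed

lemma cosh_add_le:
  fixes x y :: real
  shows "cosh (x + y) \<le> exp \<bar>y\<bar> * cosh x"
proof -
  have "sinh x * sinh y \<le> cosh x * sinh \<bar>y\<bar>"
  proof -
    have "sinh x * sinh y \<le> \<bar>sinh x\<bar> * \<bar>sinh y\<bar>" by (metis abs_ge_self abs_mult)
    also have "\<bar>sinh x\<bar> \<le> cosh x"
      using sinh_less_cosh_real[of x] sinh_less_cosh_real[of "- x"] by simp
    finally show ?thesis by (simp add: mult_right_mono)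
  qed
  moreover have "cosh y = cosh \<bar>y\<bar>" by simp
  moreover have "exp \<bar>y\<bar> = cosh \<bar>y\<bar> + sinh \<bar>y\<bar>" by (rule cosh_plus_sinh[symmetric])
  ultimately show ?thesis by (simp only: cosh_add) (simp add: algebra_simps)
qed

text \<open>The translates of \<open>{- (R - r)..R - r}\<close> by \<open>r\<close> and
  \<open>- r\<close> cover \<open>{- R..R}\<close> exactly because \<open>2 * r \<le> R\<close>. By
  \<open>cosh_add_le\<close> each translation multiplies the integrand by at most
  \<open>exp (sqrt (- k) * r) ^ (d - 1)\<close>.\<close>

lemma gcos_integral_negative_curvature_le:
  assumes k: "k < 0" and r: "0 \<le> r" "2 * r \<le> R" and small: "exp (sqrt (- k) * r) ^ (d - 1) \<le> 3"
  shows "gcos_integral d k R \<le> 6 * gcos_integral d k (R - r)"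
proof -
  define f where "f h = ennreal (gcos k h ^ (d - 1))" for h
  have [measurable]: "f \<in> borel_measurable borel" unfolding f_def by measurable
  have g: "gcos k h = cosh (sqrt (- k) * h)" for h using k by (simp add: gcos_def)
  have shift: "f (t + h) \<le> 3 * f h" if "\<bar>t\<bar> = r" for t h
  proof -
    have "gcos k (t + h) \<le> exp (sqrt (- k) * r) * gcos k h"
      unfolding g using cosh_add_le[of "sqrt (- k) * h" "sqrt (- k) * t"] that k
      by (simp add: abs_mult algebra_simps)
    then have "gcos k (t + h) ^ (d - 1) \<le> exp (sqrt (- k) * r) ^ (d - 1) * gcos k h ^ (d - 1)"
      unfolding power_mult_distrib[symmetric] by (intro power_mono) (auto simp: g)
    also have "\<dots> \<le> 3 * gcos k h ^ (d - 1)"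
      using small by (intro mult_right_mono) (auto simp: g)
    finally show ?thesis
      unfolding f_def by (subst ennreal_numeral[symmetric], subst ennreal_mult[symmetric])
        (auto simp: g intro!: ennreal_leI)
  qed
  have part: "(\<integral>\<^sup>+h. f h * indicator {t - (R - r)..t + (R - r)} h \<partial>lborel) \<le> 3 * gcos_integral d k (R - r)"
    if "\<bar>t\<bar> = r" for t
  proof -
    have "(\<integral>\<^sup>+h. f h * indicator {t - (R - r)..t + (R - r)} h \<partial>lborel) =
      (\<integral>\<^sup>+h. f (t + h) * indicator {- (R - r)..R - r} h \<partial>lborel)"
      by (subst nn_integral_real_affine[where c = 1 and t = t])
         (auto intro!: nn_integral_cong split: split_indicator)
    also have "\<dots> \<le> (\<integral>\<^sup>+h. 3 * (f h * indicator {- (R - r)..R - r} h) \<partial>lborel)"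
      using shift[OF that] by (intro nn_integral_mono) (auto split: split_indicator)
    also have "\<dots> = 3 * gcos_integral d k (R - r)"
      by (subst nn_integral_cmult) (auto simp: gcos_integral_def f_def)
    finally show ?thesis .
  qed
  have "gcos_integral d k R \<le>
    (\<integral>\<^sup>+h. f h * indicator {- r - (R - r)..- r + (R - r)} h + f h * indicator {r - (R - r)..r + (R - r)} h \<partial>lborel)"
    unfolding gcos_integral_def using r
    by (intro nn_integral_mono) (auto simp: f_def split: split_indicator)
  also have "\<dots> \<le> 3 * gcos_integral d k (R - r) + 3 * gcos_integral d k (R - r)"
    using part[of "- r"] part[of r] r by (subst nn_integral_add) (auto intro!: add_mono)
  also have "\<dots> = 6 * gcos_integral d k (R - r)"
    by (simp flip: distrib_right)
  finally show ?thesis .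
qed

text \<open>By \<open>alpha_ge\<close> it is enough to compare the mass up to \<open>R\<close> with
  the mass up to \<open>R - r\<close>, which is at least \<open>R / 2\<close>. In negative curvature
  the mass may grow exponentially in \<open>R\<close>, so halving is useless there; the loss of a
  fixed \<open>r\<close> is harmless once \<open>sqrt (- k) * r\<close> is small.\<close>

lemma gcos_mass_le_section_kernel:
  assumes "r > 0"
  obtains \<delta> where "\<delta> > 0"
    "\<And>k R. \<bar>k\<bar> < \<delta> \<Longrightarrow> 2 * r \<le> R \<Longrightarrow> ereal R \<le> max_radius k \<Longrightarrow>
      gcos_mass d k R \<le> 6 * section_kernel d k R r"
\<comment> \<open>This threshold gives \<open>sqrt (- k) * r * (d + 1) < 1\<close>, so the
  translation factor is at most \<open>exp 1\<close>. Using \<open>d + 1\<close> instead of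
  \<open>d - 1\<close> keeps the denominator positive for every \<open>d\<close>.\<close>
proof (rule that[of "(1 / (r * (d + 1)))\<^sup>2"])
  show "(1 / (r * (d + 1)))\<^sup>2 > 0" using assms by simp
  fix k R assume k: "\<bar>k\<bar> < (1 / (r * (d + 1)))\<^sup>2" and R: "2 * r \<le> R" "ereal R \<le> max_radius k"
  have "gcos_integral d k R \<le> 6 * gcos_integral d k (R - r)"
  proof (cases "0 \<le> k")
    case True
    have "gcos_integral d k R \<le> 2 * gcos_integral d k (R / 2)"
      using gcos_integral_halve True R by blast
    also have "\<dots> \<le> 6 * gcos_integral d k (R - r)"
      unfolding ennreal_gcos_mass[symmetric] using R assms gcos_mass_mono[of "R / 2" "R - r" d k]
      by (auto simp flip: ennreal_numeral ennreal_mult intro!: ennreal_leI)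
         (smt (verit) gcos_mass_nonneg)
    finally show ?thesis .
  next
    case False
    have "sqrt (- k) < 1 / (r * (d + 1))"
      using k False assms by (intro real_less_lsqrt) auto
    then have "sqrt (- k) * r * (d + 1) < 1" using assms
      by (subst (asm) pos_less_divide_eq) (auto simp: mult.assoc)
    moreover have "(d - 1) * (sqrt (- k) * r) \<le> (d + 1) * (sqrt (- k) * r)"
      using assms False by (intro mult_right_mono) auto
    ultimately have "exp ((d - 1) * (sqrt (- k) * r)) \<le> exp 1"
      by (subst exp_le_cancel_iff) (simp add: algebra_simps)
    also have "exp 1 \<le> (3 :: real)" by (rule exp_le)
    finally have "exp (sqrt (- k) * r) ^ (d - 1) \<le> 3"
      by (simp add: exp_of_nat_mult[symmetric])
    then show ?thesis
      using False assms R by (intro gcos_integral_negative_curvature_le) auto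
  qed
  also have "\<dots> \<le> 6 * gcos_integral d k (alpha k R r)"
    unfolding ennreal_gcos_mass[symmetric] using R assms
    by (intro mult_left_mono ennreal_leI gcos_mass_mono alpha_ge) auto
  finally have "ennreal (gcos_mass d k R) \<le> ennreal (6 * gcos_mass d k (alpha k R r))"
    by (simp add: ennreal_gcos_mass ennreal_mult)
  then show "gcos_mass d k R \<le> 6 * section_kernel d k R r"
    using R assms by (simp add: section_kernel_def)
qed

section \<open>Abel inversion at curvature zero\<close>

text \<open>Layer-cake formula: \<open>1 / x\<close> is the length of \<open>{0<..1 / x}\<close>,
  and \<open>s \<le> 1 / x\<close> is equivalent to \<open>x \<le> 1 / s\<close> for positive
  arguments.\<close>

lemma nn_integral_reciprocal_eq_distribution:
  fixes P :: "real measure"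
  assumes "sigma_finite_measure P" and [measurable_cong]: "sets P = sets borel"
    and [measurable]: "A \<in> sets borel"
  shows "(\<integral>\<^sup>+x. ennreal (1 / x) * indicator (A \<inter> {0<..}) x \<partial>P) =
    (\<integral>\<^sup>+s. emeasure P (A \<inter> {0<..1 / s}) * indicator {0<..} s \<partial>lborel)"
proof -
  interpret P: sigma_finite_measure P by fact
  interpret pair_sigma_finite lborel P ..
  have "(\<integral>\<^sup>+x. ennreal (1 / x) * indicator (A \<inter> {0<..}) x \<partial>P) =
    (\<integral>\<^sup>+x. (\<integral>\<^sup>+s. indicator {0<..1 / x} s * indicator (A \<inter> {0<..}) x \<partial>lborel) \<partial>P)"
    by (intro nn_integral_cong) (auto simp: nn_integral_multc split: split_indicator)
  also have "\<dots> = (\<integral>\<^sup>+x. (\<integral>\<^sup>+s. indicator {(s, x). x \<in> A \<and> 0 < x \<and> 0 < s \<and> s * x \<le> 1} (s, x) \<partial>lborel) \<partial>P)"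
    by (intro nn_integral_cong) (auto simp: field_simps split: split_indicator)
  also have "\<dots> = (\<integral>\<^sup>+s. (\<integral>\<^sup>+x. indicator {(s, x). x \<in> A \<and> 0 < x \<and> 0 < s \<and> s * x \<le> 1} (s, x) \<partial>P) \<partial>lborel)"
    by (intro Fubini') measurable
  also have "\<dots> = (\<integral>\<^sup>+s. (\<integral>\<^sup>+x. indicator (A \<inter> {0<..1 / s}) x * indicator {0<..} s \<partial>P) \<partial>lborel)"
    by (intro nn_integral_cong) (auto simp: field_simps split: split_indicator)
  also have "\<dots> = (\<integral>\<^sup>+s. emeasure P (A \<inter> {0<..1 / s}) * indicator {0<..} s \<partial>lborel)"
    by (intro nn_integral_cong) (simp add: nn_integral_multc)
  finally show ?thesis .
qed

text \<open>The function \<open>1 / x\<close> on \<open>{0<..b}\<close> is decreasing and drops to 0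
  beyond \<open>b\<close>, so its superlevel sets are intervals \<open>{0<..t}\<close>, on which the
  two measures are comparable by assumption.\<close>

lemma nn_integral_reciprocal_stochastic_order:
  fixes P M :: "real measure"
  assumes "sigma_finite_measure P" "sets P = sets borel" "sigma_finite_measure M" "sets M = sets borel"
    and "\<And>r. emeasure P {0<..r} \<le> emeasure M {0<..r}"
  shows "(\<integral>\<^sup>+x. ennreal (1 / x) * indicator {0<..b} x \<partial>P) \<le> (\<integral>\<^sup>+x. ennreal (1 / x) * indicator {0<..b} x \<partial>M)"
proof -
  have "{0<..b} \<inter> {0<..} = {0<..b}" "\<And>s. {0<..b} \<inter> {0<..1 / s} = {0<..min b (1 / s)}" by auto
  then have "(\<integral>\<^sup>+x. ennreal (1 / x) * indicator {0<..b} x \<partial>Q) =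
      (\<integral>\<^sup>+s. emeasure Q {0<..min b (1 / s)} * indicator {0<..} s \<partial>lborel)"
    if "sigma_finite_measure Q" "sets Q = sets borel" for Q :: "real measure"
    using nn_integral_reciprocal_eq_distribution[OF that, of "{0<..b}"] by simp
  then show ?thesis
    using assms by (auto intro!: nn_integral_mono mult_right_mono)
qed

text \<open>The Abel kernel \<open>r / \<surd>(r\<^sup>2 - z\<^sup>2)\<close> inverts the section kernel of curvature \<open>0\<close>. It is not
  integrable itself, but differences of two such kernels are.\<close>

definition abel_weight :: "real \<Rightarrow> real \<Rightarrow> real" where
  "abel_weight z r = (if z < r then r / sqrt (r\<^sup>2 - z\<^sup>2) else 0)"

lemma borel_measurable_abel_weight [measurable]: "abel_weight z \<in> borel_measurable borel"
  unfolding abel_weight_def by measurable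

lemma power2_less_of_less: "0 \<le> x \<Longrightarrow> x < y \<Longrightarrow> x\<^sup>2 < y\<^sup>2" for x y :: real
  by (rule power_strict_mono) auto

text \<open>The integrand is unbounded at \<open>z\<close>, but its primitive
  \<open>sqrt (r\<^sup>2 - z\<^sup>2)\<close> has a finite limit there.\<close>

lemma set_integrable_abel_weight:
  assumes z: "0 \<le> z" and zy: "z < y"
  shows "set_integrable lborel {z<..<y} (\<lambda>r. r / sqrt (r\<^sup>2 - z\<^sup>2))"
proof -
  have "set_integrable lborel (einterval z y) (\<lambda>r. r / sqrt (r\<^sup>2 - z\<^sup>2))"
  proof (rule interval_integral_FTC_nonneg[where F = "\<lambda>r. sqrt (r\<^sup>2 - z\<^sup>2)"])
    show "ereal z < ereal y" using zy by simp
    fix r assume "ereal z < ereal r" "ereal r < ereal y"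
    then have r: "0 < r\<^sup>2 - z\<^sup>2" using power2_less_of_less z by simp
    show "((\<lambda>r. sqrt (r\<^sup>2 - z\<^sup>2)) has_real_derivative r / sqrt (r\<^sup>2 - z\<^sup>2)) (at r)"
      using r by (auto intro!: derivative_eq_intros simp: field_simps)
    show "isCont (\<lambda>r. r / sqrt (r\<^sup>2 - z\<^sup>2)) r" using r by (auto intro!: continuous_intros)
  next
    show "AE r in lborel. ereal z < ereal r \<longrightarrow> ereal r < ereal y \<longrightarrow> 0 \<le> r / sqrt (r\<^sup>2 - z\<^sup>2)"
      using z power2_less_of_less by (auto intro!: AE_I2 divide_nonneg_nonneg less_imp_le)
    show "(((\<lambda>r. sqrt (r\<^sup>2 - z\<^sup>2)) \<circ> real_of_ereal) \<longlongrightarrow> 0) (at_right (ereal z))"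
      unfolding ereal_tendsto_simps by (rule tendsto_eq_intros refl | simp)+
    show "(((\<lambda>r. sqrt (r\<^sup>2 - z\<^sup>2)) \<circ> real_of_ereal) \<longlongrightarrow> sqrt (y\<^sup>2 - z\<^sup>2)) (at_left (ereal y))"
      unfolding ereal_tendsto_simps by (rule tendsto_eq_intros refl | simp)+
  qed
  then show ?thesis by simp
qed

text \<open>The difference has constant sign, and its primitive
  \<open>sqrt (r\<^sup>2 - y\<^sup>2) - sqrt (r\<^sup>2 - x\<^sup>2)\<close> vanishes at infinity
  because the linear growth of the two terms cancels.\<close>

lemma set_integrable_abel_weight_diff:
  assumes x: "0 \<le> x" and xy: "x < y"
  shows "set_integrable lborel {y<..} (\<lambda>r. r / sqrt (r\<^sup>2 - y\<^sup>2) - r / sqrt (r\<^sup>2 - x\<^sup>2))"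
proof -
  have le: "r / sqrt (r\<^sup>2 - x\<^sup>2) \<le> r / sqrt (r\<^sup>2 - y\<^sup>2)" if "y < r" for r
    using that x xy power2_less_of_less[of y r] power2_less_of_less[of x y]
    by (intro divide_left_mono mult_pos_pos) auto
  have "set_integrable lborel (einterval y \<infinity>) (\<lambda>r. r / sqrt (r\<^sup>2 - y\<^sup>2) - r / sqrt (r\<^sup>2 - x\<^sup>2))"
  proof (rule interval_integral_FTC_nonneg[where F = "\<lambda>r. sqrt (r\<^sup>2 - y\<^sup>2) - sqrt (r\<^sup>2 - x\<^sup>2)"])
    show "ereal y < \<infinity>" by simp
    fix r assume "ereal y < ereal r"
    then have r: "0 < r\<^sup>2 - y\<^sup>2" "0 < r\<^sup>2 - x\<^sup>2"
      using power2_less_of_less[of y r] power2_less_of_less[of x r] x xy by simp_all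
    show "((\<lambda>r. sqrt (r\<^sup>2 - y\<^sup>2) - sqrt (r\<^sup>2 - x\<^sup>2)) has_real_derivative
        r / sqrt (r\<^sup>2 - y\<^sup>2) - r / sqrt (r\<^sup>2 - x\<^sup>2)) (at r)"
      using r by (auto intro!: derivative_eq_intros simp: field_simps)
    show "isCont (\<lambda>r. r / sqrt (r\<^sup>2 - y\<^sup>2) - r / sqrt (r\<^sup>2 - x\<^sup>2)) r"
      using r by (auto intro!: continuous_intros)
  next
    show "AE r in lborel. ereal y < ereal r \<longrightarrow> ereal r < \<infinity> \<longrightarrow>
        0 \<le> r / sqrt (r\<^sup>2 - y\<^sup>2) - r / sqrt (r\<^sup>2 - x\<^sup>2)"
      using le by auto
    show "(((\<lambda>r. sqrt (r\<^sup>2 - y\<^sup>2) - sqrt (r\<^sup>2 - x\<^sup>2)) \<circ> real_of_ereal) \<longlongrightarrow> 0 - sqrt (y\<^sup>2 - x\<^sup>2)) (at_right (ereal y))"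
      unfolding ereal_tendsto_simps by (rule tendsto_eq_intros refl | simp)+
    show "(((\<lambda>r. sqrt (r\<^sup>2 - y\<^sup>2) - sqrt (r\<^sup>2 - x\<^sup>2)) \<circ> real_of_ereal) \<longlongrightarrow> 0) (at_left \<infinity>)"
      unfolding ereal_tendsto_simps by real_asymp
  qed
  moreover have "einterval y \<infinity> = {y<..}" by (auto simp: einterval_def)
  ultimately show ?thesis by simp
qed

lemma integrable_abel_weight_diff:
  assumes "0 \<le> x" "x < y"
  shows "integrable lborel (\<lambda>r. abel_weight x r - abel_weight y r)"
proof -
  have "integrable lborel (\<lambda>r. indicator {x<..<y} r * (r / sqrt (r\<^sup>2 - x\<^sup>2)) -
      indicator {y<..} r * (r / sqrt (r\<^sup>2 - y\<^sup>2) - r / sqrt (r\<^sup>2 - x\<^sup>2)))"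
    using set_integrable_abel_weight[OF assms] set_integrable_abel_weight_diff[OF assms]
    unfolding set_integrable_def real_scaleR_def by (rule Bochner_Integration.integrable_diff)
  moreover have "AE r in lborel. indicator {x<..<y} r * (r / sqrt (r\<^sup>2 - x\<^sup>2)) -
      indicator {y<..} r * (r / sqrt (r\<^sup>2 - y\<^sup>2) - r / sqrt (r\<^sup>2 - x\<^sup>2)) =
      abel_weight x r - abel_weight y r"
    using AE_lborel_singleton[of y]
    by eventually_elim (use assms in \<open>auto simp: abel_weight_def split: split_indicator\<close>)
  ultimately show ?thesis
    by (subst integrable_cong_AE[symmetric]) auto
qed

text \<open>The substitution \<open>r\<^sup>2 = z\<^sup>2 + c * (sin \<phi>)\<^sup>2\<close> with
  \<open>c = R\<^sup>2 - z\<^sup>2\<close> turns the integral into that of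
  \<open>c * (cos \<phi>)\<^sup>2\<close> over \<phi> from 0 to \<open>pi / 2\<close>. The primitive
  \<open>F\<close> below is \<open>c * (sin \<phi> * cos \<phi> + \<phi>) / 2\<close> written in
  terms of \<open>r\<close>.\<close>

lemma
  assumes z: "0 \<le> z" and zR: "z < R"
  shows set_integrable_abel: "set_integrable lborel {z<..<R} (\<lambda>r. r * sqrt (R\<^sup>2 - r\<^sup>2) / sqrt (r\<^sup>2 - z\<^sup>2))"
    and LBINT_abel: "(LBINT r:{z<..<R}. r * sqrt (R\<^sup>2 - r\<^sup>2) / sqrt (r\<^sup>2 - z\<^sup>2)) = pi / 4 * (R\<^sup>2 - z\<^sup>2)"
proof -
  define c where "c = R\<^sup>2 - z\<^sup>2"
  have c: "c > 0" using power2_less_of_less[OF z zR] by (simp add: c_def)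
  define F where "F r = (sqrt (R\<^sup>2 - r\<^sup>2) * sqrt (r\<^sup>2 - z\<^sup>2) + c * arcsin (sqrt ((r\<^sup>2 - z\<^sup>2) / c))) / 2" for r
  define f where "f r = r * sqrt (R\<^sup>2 - r\<^sup>2) / sqrt (r\<^sup>2 - z\<^sup>2)" for r
  have contF: "continuous_on {z..R} F"
  proof -
    have "z\<^sup>2 \<le> r\<^sup>2" "r\<^sup>2 \<le> R\<^sup>2" if "z \<le> r" "r \<le> R" for r
      using that z by (auto intro!: power_mono)
    then show ?thesis unfolding F_def using c
      by (intro continuous_intros) (auto simp: c_def intro: order.trans[of _ 0])
  qed
  have "set_integrable lborel (einterval z R) f \<and> (LBINT r=z..R. f r) = F R - F z"
  proof (intro conjI; rule interval_integral_FTC_nonneg[where F = F])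
    show "ereal z < ereal R" using zR by simp
    show "ereal z < ereal R" using zR by simp
    have der: "(F has_real_derivative f r) (at r)" if "ereal z < ereal r" "ereal r < ereal R" for r
    proof -
      define u where "u = r\<^sup>2 - z\<^sup>2"
      define v where "v = R\<^sup>2 - r\<^sup>2"
      have uv: "u > 0" "v > 0" "u + v = c"
        using power2_less_of_less[of z r] power2_less_of_less[of r R] that z by (auto simp: u_def v_def c_def)
      have uc: "0 < u / c" "u / c < 1" using uv by auto
      have 1: "((\<lambda>r. sqrt (R\<^sup>2 - r\<^sup>2)) has_real_derivative - r / sqrt v) (at r)"
        using uv by (auto intro!: derivative_eq_intros simp: v_def field_simps)
      have 2: "((\<lambda>r. sqrt (r\<^sup>2 - z\<^sup>2)) has_real_derivative r / sqrt u) (at r)"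
        using uv by (auto intro!: derivative_eq_intros simp: u_def field_simps)
      have 3: "((\<lambda>r. sqrt ((r\<^sup>2 - z\<^sup>2) / c)) has_real_derivative (r / sqrt u) / sqrt c) (at r)"
        unfolding real_sqrt_divide by (intro DERIV_cdivide 2)
      have s: "- 1 < sqrt (u / c)" "sqrt (u / c) < 1"
        using uc by (auto intro: less_le_trans[of _ 0])
      have 4: "((\<lambda>r. arcsin (sqrt ((r\<^sup>2 - z\<^sup>2) / c))) has_real_derivative
          inverse (sqrt (1 - (sqrt (u / c))\<^sup>2)) * ((r / sqrt u) / sqrt c)) (at r)"
        by (rule DERIV_chain2[OF _ 3]) (use DERIV_arcsin[OF s] in \<open>simp add: u_def\<close>)
      have "sqrt (1 - (sqrt (u / c))\<^sup>2) = sqrt v / sqrt c"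
        using uc uv c by (simp add: real_sqrt_divide[symmetric] field_simps)
      with 4 have 4: "((\<lambda>r. arcsin (sqrt ((r\<^sup>2 - z\<^sup>2) / c))) has_real_derivative r / (sqrt u * sqrt v)) (at r)"
        using c by (simp add: field_simps)
      have 5: "(F has_real_derivative
          ((- r / sqrt v) * sqrt (r\<^sup>2 - z\<^sup>2) + (r / sqrt u) * sqrt (R\<^sup>2 - r\<^sup>2) + c * (r / (sqrt u * sqrt v))) / 2) (at r)"
        unfolding F_def by (intro DERIV_cdivide DERIV_add DERIV_mult 1 2 DERIV_cmult 4)
      have "((- r / sqrt v) * sqrt u + (r / sqrt u) * sqrt v + c * (r / (sqrt u * sqrt v))) / 2 =
          r * (- (sqrt u * sqrt u) + sqrt v * sqrt v + c) / (sqrt u * sqrt v) / 2"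
        using uv by (simp add: field_simps)
      also have "- (sqrt u * sqrt u) + sqrt v * sqrt v + c = 2 * v" using uv by simp
      also have "r * (2 * v) / (sqrt u * sqrt v) / 2 = r * sqrt v / sqrt u"
        using uv by (simp add: divide_simps)
      finally show ?thesis using 5 by (simp add: u_def v_def f_def)
    qed
    show "\<And>r. ereal z < ereal r \<Longrightarrow> ereal r < ereal R \<Longrightarrow> (F has_real_derivative f r) (at r)"
      by (rule der)
    show "\<And>r. ereal z < ereal r \<Longrightarrow> ereal r < ereal R \<Longrightarrow> (F has_real_derivative f r) (at r)"
      by (rule der)
    have cont: "isCont f r" if "ereal z < ereal r" "ereal r < ereal R" for r
      using power2_less_of_less[of z r] that z unfolding f_def by (auto intro!: continuous_intros)
    show "\<And>r. ereal z < ereal r \<Longrightarrow> ereal r < ereal R \<Longrightarrow> isCont f r" by (rule cont)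
    show "\<And>r. ereal z < ereal r \<Longrightarrow> ereal r < ereal R \<Longrightarrow> isCont f r" by (rule cont)
    have "0 \<le> f r" if "ereal z < ereal r" "ereal r < ereal R" for r
      using power2_less_of_less[of z r] power2_less_of_less[of r R] that z by (simp add: f_def)
    then show "AE r in lborel. ereal z < ereal r \<longrightarrow> ereal r < ereal R \<longrightarrow> 0 \<le> f r"
      and "AE r in lborel. ereal z < ereal r \<longrightarrow> ereal r < ereal R \<longrightarrow> 0 \<le> f r" by auto
    have "(F \<longlongrightarrow> F z) (at_right z)" "(F \<longlongrightarrow> F R) (at_left R)"
      using contF zR by (auto simp: continuous_on_Icc_at_rightD continuous_on_Icc_at_leftD)
    then show "((F \<circ> real_of_ereal) \<longlongrightarrow> F z) (at_right (ereal z))"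
      "((F \<circ> real_of_ereal) \<longlongrightarrow> F z) (at_right (ereal z))"
      "((F \<circ> real_of_ereal) \<longlongrightarrow> F R) (at_left (ereal R))"
      "((F \<circ> real_of_ereal) \<longlongrightarrow> F R) (at_left (ereal R))"
      by (simp_all add: ereal_tendsto_simps)
  qed
  moreover have "F R - F z = pi / 4 * (R\<^sup>2 - z\<^sup>2)"
    using c by (simp add: F_def c_def)
  ultimately show "set_integrable lborel {z<..<R} (\<lambda>r. r * sqrt (R\<^sup>2 - r\<^sup>2) / sqrt (r\<^sup>2 - z\<^sup>2))"
    "(LBINT r:{z<..<R}. r * sqrt (R\<^sup>2 - r\<^sup>2) / sqrt (r\<^sup>2 - z\<^sup>2)) = pi / 4 * (R\<^sup>2 - z\<^sup>2)"
    using zR by (simp_all add: f_def[abs_def] interval_lebesgue_integral_def)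
qed

lemma
  assumes z: "0 \<le> z" and R: "0 < R"
  shows integrable_abel_weight_section_kernel:
      "integrable lborel (\<lambda>r. abel_weight z r * section_kernel d 0 R r)"
    and LBINT_abel_weight_section_kernel:
      "(LBINT r. abel_weight z r * section_kernel d 0 R r) = pi / 2 * max 0 (R\<^sup>2 - z\<^sup>2)"
proof -
  define g where "g r = indicator {z<..<R} r *\<^sub>R (r * sqrt (R\<^sup>2 - r\<^sup>2) / sqrt (r\<^sup>2 - z\<^sup>2))" for r
  have eq: "abel_weight z r * section_kernel d 0 R r = 2 * g r" for r
    using z by (auto simp: g_def abel_weight_def section_kernel_curvature_zero split: split_indicator)
  have "integrable lborel (\<lambda>r. abel_weight z r * section_kernel d 0 R r) \<and>
    (LBINT r. abel_weight z r * section_kernel d 0 R r) = pi / 2 * max 0 (R\<^sup>2 - z\<^sup>2)"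
  proof (cases "z < R")
    case True
    then have "z\<^sup>2 < R\<^sup>2" using power2_less_of_less z by blast
    moreover have "integrable lborel g" "(LBINT r. g r) = pi / 4 * (R\<^sup>2 - z\<^sup>2)"
      using set_integrable_abel[OF z True] LBINT_abel[OF z True]
      unfolding g_def set_integrable_def set_lebesgue_integral_def by auto
    ultimately show ?thesis unfolding eq by simp
  next
    case False
    then have "R\<^sup>2 \<le> z\<^sup>2" using R by (intro power_mono) auto
    moreover have "{z<..<R} = {}" using False by auto
    ultimately show ?thesis unfolding eq by (simp add: g_def)
  qed
  then show "integrable lborel (\<lambda>r. abel_weight z r * section_kernel d 0 R r)"
    "(LBINT r. abel_weight z r * section_kernel d 0 R r) = pi / 2 * max 0 (R\<^sup>2 - z\<^sup>2)" by auto
qed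

text \<open>For \<open>0 \<le> x < y\<close> this is the difference of
  \<open>max 0 (R\<^sup>2 - z\<^sup>2)\<close> at \<open>z = x\<close> and \<open>z = y\<close>.
  Each of the two is unbounded in \<open>R\<close>, the difference is not.\<close>

definition ramp :: "real \<Rightarrow> real \<Rightarrow> real \<Rightarrow> real" where
  "ramp x y R = max 0 (min (R\<^sup>2) (y\<^sup>2) - x\<^sup>2)"

lemma LBINT_abel_weight_diff_section_kernel:
  assumes "0 \<le> x" "x < y" "0 < R"
  shows "(LBINT r. (abel_weight x r - abel_weight y r) * section_kernel d 0 R r) = pi / 2 * ramp x y R"
proof -
  have "(LBINT r. (abel_weight x r - abel_weight y r) * section_kernel d 0 R r) =
    pi / 2 * max 0 (R\<^sup>2 - x\<^sup>2) - pi / 2 * max 0 (R\<^sup>2 - y\<^sup>2)"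
    using assms unfolding left_diff_distrib
    by (subst Bochner_Integration.integral_diff)
       (auto simp: integrable_abel_weight_section_kernel LBINT_abel_weight_section_kernel)
  also have "\<dots> = pi / 2 * ramp x y R"
    using power2_less_of_less[OF assms(1,2)] unfolding ramp_def right_diff_distrib[symmetric]
    by (auto simp: max_def min_def)
  finally show ?thesis .
qed

text \<open>Up to affine scaling, ramps are the library's continuous step functions composed with squaring,
  so the library criterion applies to the images of the measures under squaring.\<close>

lemma integral_tendsto_of_integral_ramp:
  fixes M :: "nat \<Rightarrow> real measure" and N :: "real measure"
  assumes M: "\<And>n. real_distribution (M n)" "\<And>n. AE R in M n. 0 < R"
    and N: "real_distribution N" "AE R in N. 0 < R"
    and conv: "\<And>x y. 0 \<le> x \<Longrightarrow> x < y \<Longrightarrow> (\<lambda>n. \<integral>R. ramp x y R \<partial>M n) \<longlonglongrightarrow> (\<integral>R. ramp x y R \<partial>N)"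
    and f: "continuous_on UNIV f" "bounded (range f)"
  shows "(\<lambda>n. \<integral>R. f R \<partial>M n) \<longlonglongrightarrow> (\<integral>R. f R \<partial>N :: real)"
proof -
  define S where "S P = distr P borel (\<lambda>R::real. R\<^sup>2)" for P :: "real measure"
  have S: "real_distribution (S P)" if "real_distribution P" for P
  proof -
    interpret real_distribution P by fact
    show ?thesis unfolding S_def by (rule real_distribution_distr) simp
  qed
  have intS: "(\<integral>u. g u \<partial>S P) = (\<integral>R. g (R\<^sup>2) \<partial>P)"
    if "real_distribution P" "g \<in> borel_measurable borel" for g :: "real \<Rightarrow> real" and P
  proof -
    interpret real_distribution P by fact
    show ?thesis unfolding S_def using that by (intro integral_distr) auto
  qed
  have meas: "cts_step a b \<in> borel_measurable borel" for a b
    unfolding cts_step_def[abs_def] by measurable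
  have step: "(\<integral>u. cts_step (x\<^sup>2) (y\<^sup>2) u \<partial>S P) = 1 - (\<integral>R. ramp x y R \<partial>P) / (y\<^sup>2 - x\<^sup>2)"
    if "real_distribution P" "0 \<le> x" "x < y" for P x y
  proof -
    interpret real_distribution P by fact
    have xy: "x\<^sup>2 < y\<^sup>2" using that power2_less_of_less by blast
    have int: "integrable P (ramp x y)"
    proof (rule integrable_const_bound[of _ "y\<^sup>2"])
      have "norm (ramp x y R) \<le> y\<^sup>2" for R
        using xy unfolding ramp_def by (smt (verit) real_norm_def zero_le_power2)
      then show "AE R in P. norm (ramp x y R) \<le> y\<^sup>2" by simp
    qed (simp add: ramp_def[abs_def])
    have "(\<integral>u. cts_step (x\<^sup>2) (y\<^sup>2) u \<partial>S P) = (\<integral>R. 1 - ramp x y R / (y\<^sup>2 - x\<^sup>2) \<partial>P)"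
      unfolding intS[OF that(1) meas]
      using xy by (intro Bochner_Integration.integral_cong)
        (auto simp: cts_step_def ramp_def divide_simps max_def min_def)
    also have "\<dots> = 1 - (\<integral>R. ramp x y R \<partial>P) / (y\<^sup>2 - x\<^sup>2)"
      using int prob_space by simp
    finally show ?thesis .
  qed
  have conv0: "(\<lambda>n. \<integral>u. cts_step a b u \<partial>S (M n)) \<longlonglongrightarrow> (\<integral>u. cts_step a b u \<partial>S N)"
    if "0 \<le> a" "a < b" for a b
  proof -
    have "(\<integral>u. cts_step a b u \<partial>S P) = 1 - (\<integral>R. ramp (sqrt a) (sqrt b) R \<partial>P) / (b - a)"
      if "real_distribution P" for P
      using step[OF that, of "sqrt a" "sqrt b"] \<open>0 \<le> a\<close> \<open>a < b\<close> by simp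
    moreover have "(\<lambda>n. 1 - (\<integral>R. ramp (sqrt a) (sqrt b) R \<partial>M n) / (b - a)) \<longlonglongrightarrow>
      1 - (\<integral>R. ramp (sqrt a) (sqrt b) R \<partial>N) / (b - a)"
      using that by (intro tendsto_intros conv) auto
    ultimately show ?thesis by (simp only: M(1) N(1))
  qed
  have "weak_conv_m (\<lambda>n. S (M n)) (S N)"
  proof (rule integral_cts_step_conv_imp_weak_conv)
    fix a b :: real assume ab: "a < b"
    \<comment> \<open>Squares of positive radii are positive, so only \<open>0 \<le> a\<close>
      carries information. A step with \<open>b \<le> 0\<close> vanishes there, and one with
      \<open>a < 0 < b\<close> agrees on nonnegative numbers with a multiple of the step from 0 to
      \<open>b\<close>.\<close>
    consider "0 \<le> a" | "b \<le> 0" | "a < 0" "0 < b" by linarith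
    then show "(\<lambda>n. integral\<^sup>L (S (M n)) (cts_step a b)) \<longlonglongrightarrow> integral\<^sup>L (S N) (cts_step a b)"
    proof cases
      case 1
      then show ?thesis using conv0 ab by blast
    next
      case 2
      have "integral\<^sup>L (S P) (cts_step a b) = 0" if P: "real_distribution P" "AE R in P. 0 < R" for P
      proof -
        interpret real_distribution P by fact
        have "(\<integral>R. cts_step a b (R\<^sup>2) \<partial>P) = (\<integral>R. 0 \<partial>P)"
        proof (rule integral_cong_AE)
          show "AE R in P. cts_step a b (R\<^sup>2) = 0"
            using P(2)
          proof eventually_elim
            fix R :: real assume "0 < R"
            then have "0 < R\<^sup>2" by simp
            then have "a < R\<^sup>2" "b \<le> R\<^sup>2" using 2 ab by linarith+
            then show "cts_step a b (R\<^sup>2) = 0" by (simp add: cts_step_def)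
          qed
          show "(\<lambda>R. cts_step a b (R\<^sup>2)) \<in> borel_measurable P"
            by (rule measurable_compose[OF _ meas]) simp
        qed simp
        then show ?thesis by (simp add: intS[OF P(1) meas])
      qed
      then show ?thesis using M N by simp
    next
      case 3
      have "integral\<^sup>L (S P) (cts_step a b) = b / (b - a) * (\<integral>u. cts_step 0 b u \<partial>S P)"
        if P: "real_distribution P" for P
      proof -
        have "cts_step a b (R\<^sup>2) = b / (b - a) * cts_step 0 b (R\<^sup>2)" for R
        proof -
          have "a < R\<^sup>2" using 3 zero_le_power2[of R] by linarith
          then show ?thesis using 3 by (auto simp: cts_step_def divide_simps)
        qed
        then show ?thesis unfolding intS[OF P meas] by simp
      qed
      moreover have "(\<lambda>n. b / (b - a) * (\<integral>u. cts_step 0 b u \<partial>S (M n))) \<longlonglongrightarrow> b / (b - a) * (\<integral>u. cts_step 0 b u \<partial>S N)"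
        using 3 by (intro tendsto_intros conv0) auto
      ultimately show ?thesis using M N by simp
    qed
  qed (use S M N in auto)
  moreover obtain B where B: "\<And>x. norm (f x) \<le> B" using f(2) by (auto simp: bounded_iff)
  moreover have contf: "continuous_on UNIV (\<lambda>u. f (sqrt u))"
    by (intro continuous_on_compose2[OF f(1)] continuous_intros) auto
  ultimately have "(\<lambda>n. \<integral>u. f (sqrt u) \<partial>S (M n)) \<longlonglongrightarrow> (\<integral>u. f (sqrt u) \<partial>S N)"
    by (intro weak_conv_imp_integral_bdd_continuous_conv[where B = B] S M N)
       (auto simp: continuous_on_eq_continuous_at)
  moreover have "(\<integral>u. f (sqrt u) \<partial>S P) = (\<integral>R. f R \<partial>P)"
    if P: "real_distribution P" "AE R in P. 0 < R" for P
  proof -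
    interpret real_distribution P by fact
    have [measurable]: "f \<in> borel_measurable borel"
      using f(1) by (rule borel_measurable_continuous_onI)
    have "(\<integral>u. f (sqrt u) \<partial>S P) = (\<integral>R. f (sqrt (R\<^sup>2)) \<partial>P)"
      using P by (intro intS) auto
    also have "\<dots> = (\<integral>R. f R \<partial>P)"
      by (intro integral_cong_AE) (use P(2) in auto)
    finally show ?thesis .
  qed
  ultimately show ?thesis using M N by simp
qed

section \<open>Mixtures of section laws\<close>

text \<open>Here \<sigma> is the unfolded law divided by its section mass, so it is finite but need
  not be a probability measure. After this normalisation the tail of \<mu> is linear in \<sigma>,
  and two curvatures can be compared through the common \<mu>. The tail identity is required for all
  \<open>r \<ge> 0\<close>: from the maximal radius on, both sides are 0.\<close>

locale section_mixture = finite_measure \<sigma> + mu: real_distribution \<mu>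
  for \<sigma> \<mu> :: "real measure" +
  fixes d :: nat and k :: real
  assumes sets_mixing [measurable_cong, simp]: "sets \<sigma> = sets borel"
    and mixing_radii: "AE R in \<sigma>. 0 < R \<and> ereal R \<le> max_radius k"
    and mu_pos: "AE r in \<mu>. 0 < r"
    and emeasure_tail:
      "\<And>r. 0 \<le> r \<Longrightarrow> emeasure \<mu> {r<..} = (\<integral>\<^sup>+R. ennreal (section_kernel d k R r) \<partial>\<sigma>)"
begin

lemma space_mixing [simp]: "space \<sigma> = UNIV"
  using sets_eq_imp_space_eq[OF sets_mixing] by simp

lemma measure_mu_Ioi_zero: "measure \<mu> {0<..} = 1"
  using mu_pos by (subst mu.prob_eq_1) auto

lemma measure_mu_Ioc:
  assumes "0 \<le> r"
  shows "measure \<mu> {0<..r} = 1 - measure \<mu> {r<..}"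
proof -
  have "measure \<mu> ({0<..r} \<union> {r<..}) = measure \<mu> {0<..r} + measure \<mu> {r<..}"
    by (rule mu.finite_measure_Union) auto
  moreover have "{0<..r} \<union> {r<..} = {0<..}" using assms by auto
  ultimately show ?thesis using measure_mu_Ioi_zero by simp
qed

lemma
  assumes "0 \<le> r"
  shows integrable_section_kernel: "integrable \<sigma> (\<lambda>R. section_kernel d k R r)"
    and integral_section_kernel: "(\<integral>R. section_kernel d k R r \<partial>\<sigma>) = measure \<mu> {r<..}"
proof -
  have fin: "(\<integral>\<^sup>+R. ennreal (section_kernel d k R r) \<partial>\<sigma>) = ennreal (measure \<mu> {r<..})"
    using emeasure_tail[OF assms] by (simp add: mu.emeasure_eq_measure)
  show "integrable \<sigma> (\<lambda>R. section_kernel d k R r)"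
    by (rule integrableI_nn_integral_finite[OF _ _ fin]) auto
  show "(\<integral>R. section_kernel d k R r \<partial>\<sigma>) = measure \<mu> {r<..}"
    using fin by (subst integral_eq_nn_integral) auto
qed

lemma AE_section_kernel_zero_right: "AE R in \<sigma>. section_kernel d k R 0 = gcos_mass d k R"
  using mixing_radii by eventually_elim (simp add: section_kernel_zero_right)

lemma
  shows integrable_gcos_mass: "integrable \<sigma> (gcos_mass d k)"
    and integral_gcos_mass: "(\<integral>R. gcos_mass d k R \<partial>\<sigma>) = 1"
proof -
  show "integrable \<sigma> (gcos_mass d k)"
    using integrable_section_kernel[of 0] AE_section_kernel_zero_right
    by (subst integrable_cong_AE[symmetric]) auto
  show "(\<integral>R. gcos_mass d k R \<partial>\<sigma>) = 1"
    using integral_section_kernel[of 0] AE_section_kernel_zero_right measure_mu_Ioi_zero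
    by (subst integral_cong_AE[symmetric]) auto
qed

text \<open>A section of a ball is no larger than the ball. For \<open>R \<le> r\<close> the kernel
  at \<open>r\<close> vanishes, and for larger \<open>R\<close> it is at most
  \<open>gcos_mass d k R\<close>; so the mass restricted to \<open>{0<..r}\<close> is at most the
  mass minus the kernel, whose \<sigma>-integral is the distribution function of \<mu>.\<close>

lemma emeasure_density_gcos_mass_le:
  "emeasure (density \<sigma> (\<lambda>R. ennreal (gcos_mass d k R))) {0<..r} \<le> emeasure \<mu> {0<..r}"
proof (cases "0 \<le> r")
  case True
  have G: "integrable \<sigma> (\<lambda>R. gcos_mass d k R * indicator {0<..r} R)"
    by (rule Bochner_Integration.integrable_bound[OF integrable_gcos_mass]) (auto split: split_indicator)
  have "emeasure (density \<sigma> (\<lambda>R. ennreal (gcos_mass d k R))) {0<..r} =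
      (\<integral>\<^sup>+R. ennreal (gcos_mass d k R * indicator {0<..r} R) \<partial>\<sigma>)"
    by (subst emeasure_density) (auto intro!: nn_integral_cong split: split_indicator)
  also have "\<dots> = ennreal (\<integral>R. gcos_mass d k R * indicator {0<..r} R \<partial>\<sigma>)"
    using G by (intro nn_integral_eq_integral) auto
  also have "(\<integral>R. gcos_mass d k R * indicator {0<..r} R \<partial>\<sigma>) \<le>
      (\<integral>R. gcos_mass d k R - section_kernel d k R r \<partial>\<sigma>)"
  proof (rule integral_mono_AE)
    show "AE R in \<sigma>. gcos_mass d k R * indicator {0<..r} R \<le> gcos_mass d k R - section_kernel d k R r"
      by (rule AE_I2) (auto simp: section_kernel_le section_kernel_def split: split_indicator
          intro!: gcos_mass_mono alpha_le)
  qed (use G integrable_gcos_mass integrable_section_kernel True in auto)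
  also have "\<dots> = measure \<mu> {0<..r}"
    using integrable_gcos_mass integrable_section_kernel True
    by (simp add: integral_gcos_mass integral_section_kernel measure_mu_Ioc)
  finally show ?thesis by (simp add: mu.emeasure_eq_measure ennreal_leI)
qed simp

text \<open>On \<open>{0<..\<epsilon>}\<close> the hypothesis gives
  \<open>R \<le> gcos_mass d k R\<close>, so 1 is at most \<open>gcos_mass d k R / R\<close>. This
  moves the estimate to the mass-weighted measure, which is stochastically larger than \<mu>, while
  \<open>1 / x\<close> decreases.\<close>

lemma emeasure_mixing_Ioc_le:
  assumes b: "0 < b" "\<epsilon> \<le> b" and mass: "\<And>R. 0 \<le> R \<Longrightarrow> min R b \<le> gcos_mass d k R"
  shows "emeasure \<sigma> {0<..\<epsilon>} \<le> (\<integral>\<^sup>+x. ennreal (1 / x) * indicator {0<..\<epsilon>} x \<partial>\<mu>)"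
proof -
  define P where "P = density \<sigma> (\<lambda>R. ennreal (gcos_mass d k R))"
  have P1: "sets P = sets borel" by (simp add: P_def)
  have "emeasure P (space P) = (\<integral>\<^sup>+R. ennreal (gcos_mass d k R) \<partial>\<sigma>)"
    by (simp add: P_def emeasure_density)
  also have "\<dots> = 1"
    using integrable_gcos_mass integral_gcos_mass by (subst nn_integral_eq_integral) auto
  finally have "finite_measure P" by (intro finite_measureI) simp
  then have P2: "sigma_finite_measure P" by (rule finite_measure.sigma_finite_measure)
  have "1 \<le> gcos_mass d k R * (1 / R)" if "0 < R" "R \<le> \<epsilon>" for R
    using mass[of R] that b by (simp add: field_simps min_def split: if_splits)
  then have "emeasure \<sigma> {0<..\<epsilon>} \<le>
      (\<integral>\<^sup>+R. ennreal (gcos_mass d k R) * (ennreal (1 / R) * indicator {0<..\<epsilon>} R) \<partial>\<sigma>)"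
    by (subst nn_integral_indicator[symmetric], simp, intro nn_integral_mono)
       (auto simp: mult.assoc[symmetric] simp flip: ennreal_mult split: split_indicator)
  also have "\<dots> = (\<integral>\<^sup>+x. ennreal (1 / x) * indicator {0<..\<epsilon>} x \<partial>P)"
    unfolding P_def by (subst nn_integral_density) auto
  also have "\<dots> \<le> (\<integral>\<^sup>+x. ennreal (1 / x) * indicator {0<..\<epsilon>} x \<partial>\<mu>)"
    using emeasure_density_gcos_mass_le P1 P2 mu.sigma_finite_measure
    by (intro nn_integral_reciprocal_stochastic_order) (auto simp: P_def)
  finally show ?thesis .
qed

lemma
  fixes w :: "real \<Rightarrow> real"
  assumes w: "integrable lborel w" and neg: "\<And>r. r < 0 \<Longrightarrow> w r = 0"
  shows integrable_weighted_kernel: "integrable \<sigma> (\<lambda>R. LBINT r. w r * section_kernel d k R r)"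
    and integral_weighted_kernel:
      "(\<integral>R. (LBINT r. w r * section_kernel d k R r) \<partial>\<sigma>) = (LBINT r. w r * measure \<mu> {r<..})"
proof -
  note fst = nn_integral_fst
  interpret pair_sigma_finite lborel \<sigma> ..
  have [measurable]: "w \<in> borel_measurable borel" using w by auto
  have "(\<integral>\<^sup>+p. ennreal (norm (case p of (r, R) \<Rightarrow> w r * section_kernel d k R r)) \<partial>(lborel \<Otimes>\<^sub>M \<sigma>)) =
    (\<integral>\<^sup>+r. (\<integral>\<^sup>+R. ennreal \<bar>w r\<bar> * ennreal (section_kernel d k R r) \<partial>\<sigma>) \<partial>lborel)"
    using fst[of "\<lambda>p. ennreal (norm (case p of (r, R) \<Rightarrow> w r * section_kernel d k R r))" lborel]
    by (simp add: abs_mult ennreal_mult)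
  also have "\<dots> = (\<integral>\<^sup>+r. ennreal \<bar>w r\<bar> * (\<integral>\<^sup>+R. ennreal (section_kernel d k R r) \<partial>\<sigma>) \<partial>lborel)"
    by (simp add: nn_integral_cmult)
  also have "\<dots> \<le> (\<integral>\<^sup>+r. ennreal \<bar>w r\<bar> \<partial>lborel)"
  proof (rule nn_integral_mono)
    fix r
    show "ennreal \<bar>w r\<bar> * (\<integral>\<^sup>+R. ennreal (section_kernel d k R r) \<partial>\<sigma>) \<le> ennreal \<bar>w r\<bar>"
    proof (cases "r < 0")
      case False
      then have "(\<integral>\<^sup>+R. ennreal (section_kernel d k R r) \<partial>\<sigma>) \<le> 1"
        by (subst emeasure_tail[symmetric]) (auto simp: mu.emeasure_le_1)
      then show ?thesis using mult_left_mono[of _ 1 "ennreal \<bar>w r\<bar>"] by simp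
    qed (simp add: neg)
  qed
  also have "\<dots> < \<infinity>" using w by (simp add: integrable_iff_bounded)
  finally have int: "integrable (lborel \<Otimes>\<^sub>M \<sigma>) (\<lambda>(r, R). w r * section_kernel d k R r)"
    by (intro integrableI_bounded) auto
  show "integrable \<sigma> (\<lambda>R. LBINT r. w r * section_kernel d k R r)"
    by (rule integrable_snd[OF int])
  have "(\<integral>R. (LBINT r. w r * section_kernel d k R r) \<partial>\<sigma>) =
      (LBINT r. (\<integral>R. w r * section_kernel d k R r \<partial>\<sigma>))"
    by (rule Fubini_integral[OF int])
  also have "\<dots> = (LBINT r. w r * measure \<mu> {r<..})"
  proof (rule Bochner_Integration.integral_cong[OF refl])
    fix r
    show "(\<integral>R. w r * section_kernel d k R r \<partial>\<sigma>) = w r * measure \<mu> {r<..}"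
      by (cases "r < 0") (simp_all add: neg integral_section_kernel)
  qed
  finally show "(\<integral>R. (LBINT r. w r * section_kernel d k R r) \<partial>\<sigma>) = (LBINT r. w r * measure \<mu> {r<..})" .
qed

end

lemma integrable_weight_times_kernel:
  assumes [simp]: "integrable lborel w"
  shows "integrable lborel (\<lambda>r. w r * section_kernel d k R r)"
proof -
  have [measurable]: "w \<in> borel_measurable borel"
    using borel_measurable_integrable[OF assms] by simp
  show ?thesis
  proof (rule Bochner_Integration.integrable_bound[of _ "\<lambda>r. w r * gcos_mass d k R"])
    show "AE r in lborel. norm (w r * section_kernel d k R r) \<le> norm (w r * gcos_mass d k R)"
      by (rule AE_I2) (auto simp: abs_mult intro!: mult_left_mono section_kernel_le)
  qed auto
qed

lemma abs_weighted_kernel_le: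
  assumes [simp]: "integrable lborel w"
  shows "\<bar>LBINT r. w r * section_kernel d k R r\<bar> \<le> (LBINT r. \<bar>w r\<bar>) * gcos_mass d k R"
proof -
  have "\<bar>LBINT r. w r * section_kernel d k R r\<bar> \<le> (LBINT r. \<bar>w r * section_kernel d k R r\<bar>)"
    by (rule integral_abs_bound)
  also have "\<dots> \<le> (LBINT r. \<bar>w r\<bar> * gcos_mass d k R)"
  proof (rule integral_mono)
    show "integrable lborel (\<lambda>r. \<bar>w r * section_kernel d k R r\<bar>)"
      by (rule integrable_abs[OF integrable_weight_times_kernel[OF assms]])
  qed (auto simp: abs_mult intro!: mult_left_mono section_kernel_le)
  finally show ?thesis by simp
qed

section \<open>Integrability of the reciprocal radius under the sectional law\<close>

text \<open>With \<open>x = R * s\<close> the defect is \<open>2 * R\<close> for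
  \<open>x \<le> 1\<close> and decays like \<open>R / x\<^sup>2\<close> for large \<open>x\<close>.
  The majorant has both properties and an arctangent as primitive in \<open>s\<close>, so that its
  integral over positive \<open>s\<close> does not depend on \<open>R\<close>.\<close>

lemma section_kernel_defect_curvature_zero_le:
  assumes "0 < R" "0 < s"
  shows "gcos_mass d 0 R - section_kernel d 0 R (1 / s) \<le> 4 * (R / (1 + (R * s)\<^sup>2))"
proof -
  define x where "x = R * s"
  have x: "x > 0" using assms by (simp add: x_def)
  have "1 - sqrt (max 0 (1 - 1 / x\<^sup>2)) \<le> 2 / (1 + x\<^sup>2)"
  proof (cases "x \<le> 1")
    case True
    then have "x\<^sup>2 \<le> 1" using x by (simp add: power_le_one)
    then have "1 \<le> 2 / (1 + x\<^sup>2)" by (simp add: pos_le_divide_eq add_pos_nonneg)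
    then show ?thesis by (smt (verit) real_sqrt_ge_0_iff)
  next
    case False
    then have x1: "1 < x\<^sup>2" by (simp add: one_less_power)
    then have q1: "1 / x\<^sup>2 \<le> 1" by (subst divide_le_eq_1_pos) linarith+
    define q where "q = sqrt (1 - 1 / x\<^sup>2)"
    have q: "0 \<le> q" "q * q = 1 - 1 / x\<^sup>2" using q1 by (auto simp: q_def)
    \<comment> \<open>Multiplying by the conjugate removes the square root at the cost of a factor
      of at most 2.\<close>
    have "1 - q \<le> (1 - q) * (1 + q)"
      using q x1 by (simp add: mult_le_cancel_left1 q_def)
    also have "\<dots> = 1 / x\<^sup>2" using q by (simp add: algebra_simps)
    also have "\<dots> \<le> 2 / (1 + x\<^sup>2)" using x1 by (simp add: divide_simps)
    finally show ?thesis using q1 by (simp add: q_def)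
  qed
  then have "2 * R * (1 - sqrt (max 0 (1 - 1 / x\<^sup>2))) \<le> 2 * R * (2 / (1 + x\<^sup>2))"
    using assms by (intro mult_left_mono) auto
  moreover have "section_kernel d 0 R (1 / s) = 2 * R * sqrt (max 0 (1 - 1 / x\<^sup>2))"
  proof (cases "1 < x")
    case True
    have "R\<^sup>2 - (1 / s)\<^sup>2 = R\<^sup>2 * (1 - 1 / x\<^sup>2)"
      using assms by (simp add: x_def field_simps)
    moreover have "1 / s < R" using True assms by (simp add: x_def field_simps)
    ultimately show ?thesis
      using True assms by (simp add: section_kernel_curvature_zero real_sqrt_mult one_less_power less_imp_le max_def)
  next
    case False
    then have "x\<^sup>2 \<le> 1" using x by (simp add: power_le_one)
    then have "1 - 1 / x\<^sup>2 \<le> 0" using x by simp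
    moreover have "R \<le> 1 / s" using False assms by (simp add: x_def field_simps)
    ultimately show ?thesis
      by (simp add: section_kernel_curvature_zero max_def)
  qed
  ultimately show ?thesis using assms by (simp add: x_def algebra_simps)
qed

text \<open>The layer-cake formula asks for the integral over \<open>s\<close> of the \<mu>-measure
  of \<open>{0<..1 / s}\<close>, which is the \<sigma>-integral of the defect above. After
  exchanging the integrals, the inner one is at most \<open>4 * (pi / 2)\<close> for every radius,
  and \<sigma> is finite.\<close>

lemma nn_integral_reciprocal_finite:
  assumes "section_mixture \<sigma> \<mu> d 0"
  shows "(\<integral>\<^sup>+x. ennreal (1 / x) * indicator {0<..} x \<partial>\<mu>) < \<infinity>"
proof -
  interpret section_mixture \<sigma> \<mu> d 0 by fact
  interpret pair_sigma_finite lborel \<sigma> ..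
  have "(\<integral>\<^sup>+x. ennreal (1 / x) * indicator {0<..} x \<partial>\<mu>) =
      (\<integral>\<^sup>+s. emeasure \<mu> {0<..1 / s} * indicator {0<..} s \<partial>lborel)"
    using nn_integral_reciprocal_eq_distribution[OF mu.sigma_finite_measure, of UNIV] by simp
  also have "\<dots> \<le> (\<integral>\<^sup>+s. (\<integral>\<^sup>+R. ennreal (4 * (R / (1 + (R * s)\<^sup>2))) * indicator {0<..} R * indicator {0<..} s \<partial>\<sigma>) \<partial>lborel)"
  proof (rule nn_integral_mono)
    fix s :: real
    show "emeasure \<mu> {0<..1 / s} * indicator {0<..} s \<le>
      (\<integral>\<^sup>+R. ennreal (4 * (R / (1 + (R * s)\<^sup>2))) * indicator {0<..} R * indicator {0<..} s \<partial>\<sigma>)"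
    proof (cases "0 < s")
      case True
      have int: "integrable \<sigma> (\<lambda>R. gcos_mass d 0 R - section_kernel d 0 R (1 / s))"
        using True integrable_gcos_mass integrable_section_kernel by auto
      have "emeasure \<mu> {0<..1 / s} = ennreal (\<integral>R. gcos_mass d 0 R - section_kernel d 0 R (1 / s) \<partial>\<sigma>)"
        using True integrable_gcos_mass integrable_section_kernel
        by (simp add: mu.emeasure_eq_measure measure_mu_Ioc integral_gcos_mass integral_section_kernel)
      also have "\<dots> = (\<integral>\<^sup>+R. ennreal (gcos_mass d 0 R - section_kernel d 0 R (1 / s)) \<partial>\<sigma>)"
        using int by (intro nn_integral_eq_integral[symmetric]) (auto simp: section_kernel_le)
      also have "\<dots> \<le> (\<integral>\<^sup>+R. ennreal (4 * (R / (1 + (R * s)\<^sup>2))) * indicator {0<..} R \<partial>\<sigma>)"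
      proof (rule nn_integral_mono_AE)
        show "AE R in \<sigma>. ennreal (gcos_mass d 0 R - section_kernel d 0 R (1 / s)) \<le>
          ennreal (4 * (R / (1 + (R * s)\<^sup>2))) * indicator {0<..} R"
          using mixing_radii
        proof eventually_elim
          fix R assume "0 < R \<and> ereal R \<le> max_radius 0"
          then show "ennreal (gcos_mass d 0 R - section_kernel d 0 R (1 / s)) \<le>
            ennreal (4 * (R / (1 + (R * s)\<^sup>2))) * indicator {0<..} R"
            using section_kernel_defect_curvature_zero_le[of R s d] True by (auto intro!: ennreal_leI)
        qed
      qed
      finally show ?thesis using True by simp
    qed simp
  qed
  also have "\<dots> = (\<integral>\<^sup>+R. (\<integral>\<^sup>+s. ennreal (4 * (R / (1 + (R * s)\<^sup>2))) * indicator {0<..} R * indicator {0<..} s \<partial>lborel) \<partial>\<sigma>)"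
    by (rule Fubini'[symmetric]) measurable
  also have "\<dots> \<le> (\<integral>\<^sup>+R. ennreal (4 * (pi / 2)) \<partial>\<sigma>)"
  proof (rule nn_integral_mono)
    fix R :: real
    show "(\<integral>\<^sup>+s. ennreal (4 * (R / (1 + (R * s)\<^sup>2))) * indicator {0<..} R * indicator {0<..} s \<partial>lborel) \<le> ennreal (4 * (pi / 2))"
    proof (cases "0 < R")
      case True
      have "(\<integral>\<^sup>+s. ennreal (4 * (R / (1 + (R * s)\<^sup>2))) * indicator {0<..} R * indicator {0<..} s \<partial>lborel) \<le>
        (\<integral>\<^sup>+s. ennreal (4 * (R / (1 + (R * s)\<^sup>2))) * indicator {0..} s \<partial>lborel)"
        using True by (intro nn_integral_mono) (auto split: split_indicator)
      also have "\<dots> = ennreal (4 * (pi / 2) - 4 * arctan (R * 0))"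
      proof (rule nn_integral_FTC_atLeast[where F = "\<lambda>s. 4 * arctan (R * s)"])
        show "((\<lambda>s. 4 * arctan (R * s)) has_real_derivative 4 * (R / (1 + (R * s)\<^sup>2))) (at s)" for s
          by (auto intro!: derivative_eq_intros simp: field_simps)
        have "filterlim (\<lambda>s. R * s) at_top at_top"
          using True by (intro filterlim_tendsto_pos_mult_at_top[OF tendsto_const] filterlim_ident)
        then show "((\<lambda>s. 4 * arctan (R * s)) \<longlongrightarrow> 4 * (pi / 2)) at_top"
          by (intro tendsto_intros filterlim_compose[OF tendsto_arctan_at_top])
      qed (use True in auto)
      finally show ?thesis by simp
    qed simp
  qed
  also have "\<dots> < \<infinity>"
    by (simp add: less_top[symmetric] ennreal_mult_eq_top_iff)
  finally show ?thesis .
qed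

lemma borel_measurable_ramp [measurable]: "ramp x y \<in> borel_measurable borel"
  unfolding ramp_def[abs_def] by measurable

lemma ramp_nonneg [simp]: "0 \<le> ramp x y R"
  by (simp add: ramp_def)

lemma ramp_le: "ramp x y R \<le> y\<^sup>2"
  unfolding ramp_def by (smt (verit) zero_le_power2)

section \<open>Uniform mass bounds and tightness\<close>

context section_mixture
begin

lemma integrable_ramp [simp]: "integrable \<sigma> (ramp x y)"
  by (rule integrable_const_bound[of _ "y\<^sup>2"]) (auto simp: ramp_le)

lemma measure_mixing_Ioi_le:
  assumes b: "1 \<le> b" and mass: "\<And>R. 0 \<le> R \<Longrightarrow> min R b \<le> gcos_mass d k R"
  shows "measure \<sigma> {b<..} \<le> (\<integral>R. gcos_mass d k R * indicator {b<..} R \<partial>\<sigma>)"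
proof -
  have "measure \<sigma> {b<..} = (\<integral>R. indicator {b<..} R \<partial>\<sigma>)" by simp
  also have "\<dots> \<le> (\<integral>R. gcos_mass d k R * indicator {b<..} R \<partial>\<sigma>)"
  proof (rule integral_mono)
    show "integrable \<sigma> (\<lambda>R. gcos_mass d k R * indicator {b<..} R)"
      using integrable_gcos_mass
      by (rule Bochner_Integration.integrable_bound) (auto split: split_indicator)
    fix R
    show "(indicator {b<..} R :: real) \<le> gcos_mass d k R * indicator {b<..} R"
      using mass[of R] b by (auto split: split_indicator)
  qed (simp_all add: emeasure_eq_measure)
  finally show ?thesis .
qed

text \<open>The bound involves \<mu> alone, hence is uniform in the curvature and in \<sigma>: radii
  up to \<open>b\<close> cost the reciprocal moment, and larger radii at most the normalisation 1 of
  the mass-weighted measure.\<close>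

lemma measure_mixing_le:
  assumes b: "1 \<le> b" and mass: "\<And>R. 0 \<le> R \<Longrightarrow> min R b \<le> gcos_mass d k R"
    and fin: "(\<integral>\<^sup>+x. ennreal (1 / x) * indicator {0<..} x \<partial>\<mu>) < \<infinity>"
  shows "measure \<sigma> UNIV \<le> enn2real (\<integral>\<^sup>+x. ennreal (1 / x) * indicator {0<..} x \<partial>\<mu>) + 1"
proof -
  have "measure \<sigma> UNIV = measure \<sigma> ({0<..b} \<union> {b<..})"
    by (rule finite_measure_eq_AE) (use mixing_radii in \<open>auto elim!: eventually_mono\<close>)
  also have "\<dots> = measure \<sigma> {0<..b} + measure \<sigma> {b<..}"
    by (rule finite_measure_Union) auto
  also have "measure \<sigma> {0<..b} \<le> enn2real (\<integral>\<^sup>+x. ennreal (1 / x) * indicator {0<..} x \<partial>\<mu>)"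
    unfolding measure_def
  proof (rule enn2real_mono)
    have "emeasure \<sigma> {0<..b} \<le> (\<integral>\<^sup>+x. ennreal (1 / x) * indicator {0<..b} x \<partial>\<mu>)"
      using b mass by (intro emeasure_mixing_Ioc_le[of b]) auto
    also have "\<dots> \<le> (\<integral>\<^sup>+x. ennreal (1 / x) * indicator {0<..} x \<partial>\<mu>)"
      by (intro nn_integral_mono) (auto split: split_indicator)
    finally show "emeasure \<sigma> {0<..b} \<le> (\<integral>\<^sup>+x. ennreal (1 / x) * indicator {0<..} x \<partial>\<mu>)" .
  qed (use fin in simp)
  also have "measure \<sigma> {b<..} \<le> (\<integral>R. gcos_mass d k R * indicator {b<..} R \<partial>\<sigma>)"
    using b mass by (rule measure_mixing_Ioi_le)
  also have "\<dots> \<le> (\<integral>R. gcos_mass d k R \<partial>\<sigma>)"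
  proof (rule integral_mono)
    show "integrable \<sigma> (\<lambda>R. gcos_mass d k R * indicator {b<..} R)"
      using integrable_gcos_mass
      by (rule Bochner_Integration.integrable_bound) (auto split: split_indicator)
  qed (auto simp: integrable_gcos_mass split: split_indicator)
  also have "\<dots> = 1" by (rule integral_gcos_mass)
  finally show ?thesis by simp
qed

text \<open>Tightness of the mass-weighted measures: their tails at \<open>2 * r\<close> are
  controlled by the tail of \<mu> at \<open>r\<close>, which is the same for all curvatures.\<close>

lemma integral_gcos_mass_Ioi_le:
  assumes r: "0 \<le> r"
    and kernel: "\<And>R. 2 * r \<le> R \<Longrightarrow> ereal R \<le> max_radius k \<Longrightarrow> gcos_mass d k R \<le> 6 * section_kernel d k R r"
  shows "(\<integral>R. gcos_mass d k R * indicator {2 * r<..} R \<partial>\<sigma>) \<le> 6 * measure \<mu> {r<..}"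
proof -
  have "(\<integral>R. gcos_mass d k R * indicator {2 * r<..} R \<partial>\<sigma>) \<le> (\<integral>R. 6 * section_kernel d k R r \<partial>\<sigma>)"
  proof (rule integral_mono_AE)
    show "integrable \<sigma> (\<lambda>R. gcos_mass d k R * indicator {2 * r<..} R)"
      using integrable_gcos_mass
      by (rule Bochner_Integration.integrable_bound) (auto split: split_indicator)
    show "integrable \<sigma> (\<lambda>R. 6 * section_kernel d k R r)"
      using integrable_section_kernel[OF r] by simp
    show "AE R in \<sigma>. gcos_mass d k R * indicator {2 * r<..} R \<le> 6 * section_kernel d k R r"
      using mixing_radii by eventually_elim (auto intro: kernel split: split_indicator)
  qed
  then show ?thesis using integral_section_kernel[OF r] by simp
qed

end

section \<open>Convergence as the curvature tends to zero\<close>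

text \<open>The integral of \<^term>\<open>w r * measure \<mu> {r<..}\<close> does not depend on the curvature, so it suffices
  to replace the kernel of curvature \<open>k\<close> by the Euclidean one: uniformly on bounded sets of radii,
  and by tightness of the mass-weighted mixing measures on their complement.\<close>

lemma integral_ramp_near_curvature_zero:
  assumes base: "section_mixture \<sigma>\<^sub>0 \<mu> d 0" and xy: "0 \<le> x" "x < y" and e: "0 < e"
  obtains \<delta> where "\<delta> > 0"
    "\<And>k \<sigma>. \<bar>k\<bar> < \<delta> \<Longrightarrow> section_mixture \<sigma> \<mu> d k \<Longrightarrow> \<bar>(\<integral>R. ramp x y R \<partial>\<sigma>) - (\<integral>R. ramp x y R \<partial>\<sigma>\<^sub>0)\<bar> \<le> e"
proof -
  interpret base: section_mixture \<sigma>\<^sub>0 \<mu> d 0 by fact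
  define L where "L = (\<integral>\<^sup>+x. ennreal (1 / x) * indicator {0<..} x \<partial>\<mu>)"
  have Lfin: "L < \<infinity>" unfolding L_def using base by (rule nn_integral_reciprocal_finite)
  define C where "C = enn2real L + 1"
  define w where "w r = abel_weight x r - abel_weight y r" for r
  have w: "integrable lborel w" unfolding w_def using xy by (rule integrable_abel_weight_diff)
  have w0: "w r = 0" if "r < 0" for r using that xy by (simp add: w_def abel_weight_def)
  define W where "W = (LBINT r. \<bar>w r\<bar>)"
  have W: "0 \<le> W" by (simp add: W_def)
  have C: "0 < C" by (simp add: C_def add_nonneg_pos)
  \<comment> \<open>For radii above \<open>b\<close> nothing cancels: the ramp term and the weighted
    kernel are bounded separately by multiples of \<open>gcos_mass d k R\<close>, which is at least
    1 there. \<open>B\<close> is the sum of the two factors.\<close>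
  define B where "B = pi / 2 * y\<^sup>2 + W"
  have B: "0 \<le> B" using W by (simp add: B_def)
  \<comment> \<open>Large radii will contribute at most \<open>B * (6 * \<epsilon>)\<close> and
    bounded radii at most \<open>W * \<eta> * C\<close>. Each is to be at most \<open>e / 2\<close>;
    the added 1 keeps the denominators positive.\<close>
  define \<epsilon> where "\<epsilon> = e / 2 / (6 * B + 1)"
  have \<epsilon>: "0 < \<epsilon>" using e B by (simp add: \<epsilon>_def)
  define \<eta> where "\<eta> = e / 2 / (W * C + 1)"
  have \<eta>: "0 < \<eta>" using e W C by (simp add: \<eta>_def add_nonneg_pos)
  have "((\<lambda>r. measure \<mu> {..r}) \<longlongrightarrow> 1) at_top"
    using base.mu.cdf_lim_at_top_prob by (simp add: cdf_def)
  then have "eventually (\<lambda>r. 1 - \<epsilon> < measure \<mu> {..r} \<and> 1 \<le> r) at_top"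
    using \<epsilon> by (intro eventually_conj order_tendstoD eventually_ge_at_top) auto
  then obtain r0 where r0: "1 \<le> r0" "1 - \<epsilon> < measure \<mu> {..r0}"
    by (auto dest: eventually_happens)
  have "measure \<mu> {r0<..} = 1 - measure \<mu> {..r0}"
    using base.mu.prob_compl[of "{..r0}"] by (simp add: Compl_eq_Diff_UNIV[symmetric])
  then have tail: "measure \<mu> {r0<..} \<le> \<epsilon>" using r0 by simp
  \<comment> \<open>The kernel bound at \<open>r0\<close> is available for radii from
    \<open>2 * r0\<close> on, so the split is made there.\<close>
  define b where "b = 2 * r0"
  have b: "1 \<le> b" "0 < b" using r0 by (auto simp: b_def)
  obtain \<delta>1 where \<delta>1: "\<delta>1 > 0" and kernel: "\<And>k R. \<bar>k\<bar> < \<delta>1 \<Longrightarrow> 2 * r0 \<le> R \<Longrightarrow>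
      ereal R \<le> max_radius k \<Longrightarrow> gcos_mass d k R \<le> 6 * section_kernel d k R r0"
    using gcos_mass_le_section_kernel[of r0 d] r0 by auto
  obtain \<delta>2 where \<delta>2: "\<delta>2 > 0" and mass: "\<And>k R. \<bar>k\<bar> < \<delta>2 \<Longrightarrow> 0 \<le> R \<Longrightarrow> min R b \<le> gcos_mass d k R"
    using gcos_mass_ge_min[OF b(2), of d] by blast
  obtain \<delta>3 where \<delta>3: "\<delta>3 > 0" and close: "\<And>k R r. \<bar>k\<bar> < \<delta>3 \<Longrightarrow> R \<le> b \<Longrightarrow>
      \<bar>section_kernel d k R r - section_kernel d 0 R r\<bar> \<le> \<eta>"
    using section_kernel_uniform_limit[OF \<eta> b(2), of d] by blast
  show thesis
  proof (rule that[of "min \<delta>1 (min \<delta>2 \<delta>3)"])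
    show "min \<delta>1 (min \<delta>2 \<delta>3) > 0" using \<delta>1 \<delta>2 \<delta>3 by simp
    fix k \<sigma> assume k: "\<bar>k\<bar> < min \<delta>1 (min \<delta>2 \<delta>3)" and mix: "section_mixture \<sigma> \<mu> d k"
    interpret section_mixture \<sigma> \<mu> d k by fact
    define H where "H \<kappa> R = (LBINT r. w r * section_kernel d \<kappa> R r)" for \<kappa> R
    \<comment> \<open>This number links the two curvatures: it is the \<sigma>-integral of
      \<open>H k\<close> and also the integral of \<open>H 0\<close> with respect to the Euclidean
      mixing measure.\<close>
    define I where "I = (LBINT r. w r * measure \<mu> {r<..})"
    have H0: "H 0 R = pi / 2 * ramp x y R" if "0 < R" for R
      unfolding H_def w_def using xy that by (rule LBINT_abel_weight_diff_section_kernel)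
    have intH: "integrable \<sigma> (H k)" "(\<integral>R. H k R \<partial>\<sigma>) = I"
      unfolding H_def I_def using integrable_weighted_kernel[OF w w0] integral_weighted_kernel[OF w w0] by auto
    have I0: "pi / 2 * (\<integral>R. ramp x y R \<partial>\<sigma>\<^sub>0) = I"
    proof -
      have "I = (\<integral>R. H 0 R \<partial>\<sigma>\<^sub>0)"
        unfolding H_def I_def using base.integral_weighted_kernel[OF w w0] by simp
      also have "\<dots> = (\<integral>R. pi / 2 * ramp x y R \<partial>\<sigma>\<^sub>0)"
      proof (rule integral_cong_AE)
        show "H 0 \<in> borel_measurable \<sigma>\<^sub>0"
          unfolding H_def using base.integrable_weighted_kernel[OF w w0] by (rule borel_measurable_integrable)
        show "AE R in \<sigma>\<^sub>0. H 0 R = pi / 2 * ramp x y R"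
          using base.mixing_radii by eventually_elim (simp add: H0)
      qed simp
      finally show ?thesis by simp
    qed
    define g where "g R = W * \<eta> + B * (gcos_mass d k R * indicator {b<..} R)" for R
    have intG: "integrable \<sigma> (\<lambda>R. gcos_mass d k R * indicator {b<..} R)"
      using integrable_gcos_mass
      by (rule Bochner_Integration.integrable_bound) (auto split: split_indicator)
    have intg: "integrable \<sigma> g" unfolding g_def using intG by simp
    have diff: "\<bar>pi / 2 * ramp x y R - H k R\<bar> \<le> g R" if R: "0 < R" for R
    proof (cases "R \<le> b")
      case True
      have int: "integrable lborel (\<lambda>r. w r * section_kernel d \<kappa> R r)" for \<kappa>
        using w by (rule integrable_weight_times_kernel)
      have "\<bar>pi / 2 * ramp x y R - H k R\<bar> =
          \<bar>LBINT r. w r * section_kernel d 0 R r - w r * section_kernel d k R r\<bar>"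
        using int unfolding H0[OF R, symmetric] H_def by simp
      also have "\<dots> \<le> (LBINT r. \<bar>w r * section_kernel d 0 R r - w r * section_kernel d k R r\<bar>)"
        by (rule integral_abs_bound)
      also have "\<dots> \<le> (LBINT r. \<bar>w r\<bar> * \<eta>)"
      proof (rule integral_mono)
        show "integrable lborel (\<lambda>r. \<bar>w r * section_kernel d 0 R r - w r * section_kernel d k R r\<bar>)"
          using int by simp
        show "integrable lborel (\<lambda>r. \<bar>w r\<bar> * \<eta>)" using w by simp
        fix r
        have "\<bar>section_kernel d 0 R r - section_kernel d k R r\<bar> \<le> \<eta>"
          using close[of k R r] k True by (simp add: abs_minus_commute)
        then show "\<bar>w r * section_kernel d 0 R r - w r * section_kernel d k R r\<bar> \<le> \<bar>w r\<bar> * \<eta>"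
          unfolding right_diff_distrib[symmetric] abs_mult by (intro mult_left_mono) auto
      qed
      also have "\<dots> = W * \<eta>" by (simp add: W_def)
      also have "\<dots> \<le> g R" using B by (simp add: g_def)
      finally show ?thesis .
    next
      case False
      have G1: "1 \<le> gcos_mass d k R" using mass[of k R] k R b False by auto
      have "\<bar>pi / 2 * ramp x y R - H k R\<bar> \<le> pi / 2 * ramp x y R + \<bar>H k R\<bar>"
        using ramp_nonneg[of x y R] by (smt (verit) mult_nonneg_nonneg pi_half_ge_zero)
      also have "\<dots> \<le> pi / 2 * y\<^sup>2 * gcos_mass d k R + W * gcos_mass d k R"
      proof (rule add_mono)
        have "pi / 2 * ramp x y R \<le> pi / 2 * y\<^sup>2" by (intro mult_left_mono ramp_le) auto
        also have "\<dots> \<le> pi / 2 * y\<^sup>2 * gcos_mass d k R" using mult_left_mono[OF G1, of "pi / 2 * y\<^sup>2"] by simp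
        finally show "pi / 2 * ramp x y R \<le> pi / 2 * y\<^sup>2 * gcos_mass d k R" .
        show "\<bar>H k R\<bar> \<le> W * gcos_mass d k R"
          unfolding H_def W_def using w by (rule abs_weighted_kernel_le)
      qed
      also have "\<dots> = B * gcos_mass d k R" by (simp add: B_def distrib_right)
      also have "\<dots> \<le> g R" using W \<eta> False by (simp add: g_def)
      finally show ?thesis .
    qed
    have massC: "measure \<sigma> UNIV \<le> C"
      unfolding C_def L_def using b(1) mass k Lfin by (intro measure_mixing_le) (auto simp: L_def)
    have "\<bar>pi / 2 * (\<integral>R. ramp x y R \<partial>\<sigma>) - I\<bar> = \<bar>\<integral>R. pi / 2 * ramp x y R - H k R \<partial>\<sigma>\<bar>"
      using intH by simp
    also have "\<dots> \<le> (\<integral>R. \<bar>pi / 2 * ramp x y R - H k R\<bar> \<partial>\<sigma>)"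
      by (rule integral_abs_bound)
    also have "\<dots> \<le> (\<integral>R. g R \<partial>\<sigma>)"
    proof (rule integral_mono_AE[OF _ intg])
      show "AE R in \<sigma>. \<bar>pi / 2 * ramp x y R - H k R\<bar> \<le> g R"
        using mixing_radii by eventually_elim (use diff in blast)
    qed (use intH in simp)
    also have "\<dots> = W * \<eta> * measure \<sigma> UNIV + B * (\<integral>R. gcos_mass d k R * indicator {b<..} R \<partial>\<sigma>)"
      unfolding g_def using intG by simp
    also have "\<dots> \<le> W * \<eta> * C + B * (6 * \<epsilon>)"
    proof (intro add_mono mult_left_mono massC)
      have "(\<integral>R. gcos_mass d k R * indicator {b<..} R \<partial>\<sigma>) \<le> 6 * measure \<mu> {r0<..}"
        unfolding b_def using r0 k kernel by (intro integral_gcos_mass_Ioi_le) auto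
      then show "(\<integral>R. gcos_mass d k R * indicator {b<..} R \<partial>\<sigma>) \<le> 6 * \<epsilon>" using tail by linarith
    qed (use W \<eta> B in auto)
    also have "\<dots> \<le> e / 2 + e / 2"
    proof (rule add_mono)
      have "W * \<eta> * C = e / 2 * (W * C / (W * C + 1))" by (simp add: \<eta>_def)
      also have "\<dots> \<le> e / 2 * 1" using W C e by (intro mult_left_mono) (auto simp: divide_le_eq_1 add_nonneg_pos)
      finally show "W * \<eta> * C \<le> e / 2" by simp
      have "6 * B + 1 \<noteq> 0" "12 * B + 2 \<noteq> 0" using B by linarith+
      then have "B * (6 * \<epsilon>) = e / 2 * (6 * B / (6 * B + 1))"
        by (simp add: \<epsilon>_def divide_simps)
      also have "\<dots> \<le> e / 2 * 1" using B e by (intro mult_left_mono) auto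
      finally show "B * (6 * \<epsilon>) \<le> e / 2" by simp
    qed
    finally have le: "pi / 2 * \<bar>(\<integral>R. ramp x y R \<partial>\<sigma>) - (\<integral>R. ramp x y R \<partial>\<sigma>\<^sub>0)\<bar> \<le> e"
      unfolding I0[symmetric] right_diff_distrib[symmetric] by (simp add: abs_mult)
    have "1 * \<bar>(\<integral>R. ramp x y R \<partial>\<sigma>) - (\<integral>R. ramp x y R \<partial>\<sigma>\<^sub>0)\<bar> \<le>
        pi / 2 * \<bar>(\<integral>R. ramp x y R \<partial>\<sigma>) - (\<integral>R. ramp x y R \<partial>\<sigma>\<^sub>0)\<bar>"
      using pi_ge_two by (intro mult_right_mono) auto
    from order.trans[OF this le] show "\<bar>(\<integral>R. ramp x y R \<partial>\<sigma>) - (\<integral>R. ramp x y R \<partial>\<sigma>\<^sub>0)\<bar> \<le> e" by simp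
  qed
qed

section \<open>Convergence of the total masses\<close>

text \<open>The measure with density \<open>1 / x\<close> on positive numbers is finite, and the
  intervals \<open>{0<..1 / real (Suc n)}\<close> decrease to the empty set.\<close>

lemma nn_integral_reciprocal_Ioc_small:
  fixes \<mu> :: "real measure"
  assumes [measurable_cong]: "sets \<mu> = sets borel"
    and fin: "(\<integral>\<^sup>+x. ennreal (1 / x) * indicator {0<..} x \<partial>\<mu>) < \<infinity>" and e: "0 < e"
  obtains y :: real where "0 < y" "y \<le> 1" "(\<integral>\<^sup>+x. ennreal (1 / x) * indicator {0<..y} x \<partial>\<mu>) < ennreal e"
proof -
  define P where "P = density \<mu> (\<lambda>x. ennreal (1 / x) * indicator {0<..} x)"
  have P: "emeasure P A = (\<integral>\<^sup>+x. ennreal (1 / x) * indicator ({0<..} \<inter> A) x \<partial>\<mu>)" if "A \<in> sets borel" for A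
    unfolding P_def using that
    by (subst emeasure_density) (auto simp: assms(1) mult.assoc indicator_inter_arith intro!: nn_integral_cong split: split_indicator)
  define A where "A n = {0<..1 / real (Suc n)}" for n
  have dec: "decseq A"
  proof (rule decseq_SucI)
    fix n
    have "1 / real (Suc (Suc n)) \<le> 1 / real (Suc n)" by (simp add: frac_le)
    then show "A (Suc n) \<subseteq> A n" unfolding A_def by auto
  qed
  have "(\<Inter>n. A n) = {}"
  proof -
    have False if "\<And>n. x \<in> A n" for x
    proof -
      have "0 < x" using that[of 0] by (simp add: A_def)
      then obtain n where "inverse (real (Suc n)) < x" using reals_Archimedean by blast
      then show False using that[of n] by (simp add: A_def inverse_eq_divide)
    qed
    then show ?thesis by blast
  qed
  moreover have "(\<lambda>n. emeasure P (A n)) \<longlonglongrightarrow> emeasure P (\<Inter>n. A n)"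
  proof (rule Lim_emeasure_decseq[OF _ dec])
    show "range A \<subseteq> sets P" by (auto simp: P_def A_def assms(1))
    fix n
    have "emeasure P (A n) \<le> (\<integral>\<^sup>+x. ennreal (1 / x) * indicator {0<..} x \<partial>\<mu>)"
      by (subst P) (auto simp: A_def intro!: nn_integral_mono split: split_indicator)
    then show "emeasure P (A n) \<noteq> \<infinity>" using fin by (auto simp: top_unique)
  qed
  ultimately have "(\<lambda>n. emeasure P (A n)) \<longlonglongrightarrow> 0" by simp
  then have "eventually (\<lambda>n. emeasure P (A n) < ennreal e) sequentially"
    using e by (intro order_tendstoD) auto
  then obtain n where n: "emeasure P (A n) < ennreal e" by (auto dest: eventually_happens)
  have "{0<..} \<inter> A n = A n" by (auto simp: A_def)
  then have "emeasure P (A n) = (\<integral>\<^sup>+x. ennreal (1 / x) * indicator (A n) x \<partial>\<mu>)"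
    by (subst P) (auto simp: A_def)
  with n show thesis by (intro that[of "1 / real (Suc n)"]) (auto simp: A_def)
qed

text \<open>The function \<open>ramp 0 y R / y\<^sup>2\<close> lies between 0 and 1 and equals 1 for
  \<open>R \<ge> y\<close>. It thus differs from the constant 1 only on \<open>{0<..y}\<close>,
  whose \<sigma>-measure is bounded by the reciprocal moment of \<mu>.\<close>

lemma (in section_mixture) measure_mixing_minus_ramp:
  assumes y: "0 < y" "y \<le> 1" and mass: "\<And>R. 0 \<le> R \<Longrightarrow> min R 1 \<le> gcos_mass d k R"
    and e: "0 \<le> e" "(\<integral>\<^sup>+x. ennreal (1 / x) * indicator {0<..y} x \<partial>\<mu>) \<le> ennreal e"
  shows "\<bar>measure \<sigma> UNIV - (\<integral>R. ramp 0 y R \<partial>\<sigma>) / y\<^sup>2\<bar> \<le> e"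
proof -
  have "measure \<sigma> UNIV - (\<integral>R. ramp 0 y R \<partial>\<sigma>) / y\<^sup>2 = (\<integral>R. 1 - ramp 0 y R / y\<^sup>2 \<partial>\<sigma>)"
    by simp
  moreover have "0 \<le> (\<integral>R. 1 - ramp 0 y R / y\<^sup>2 \<partial>\<sigma>)"
    using y ramp_le[of 0 y] by (intro Bochner_Integration.integral_nonneg) (simp add: divide_le_eq_1)
  moreover have "(\<integral>R. 1 - ramp 0 y R / y\<^sup>2 \<partial>\<sigma>) \<le> (\<integral>R. indicator {0<..y} R \<partial>\<sigma>)"
  proof (rule integral_mono_AE)
    show "AE R in \<sigma>. 1 - ramp 0 y R / y\<^sup>2 \<le> indicator {0<..y} R"
      using mixing_radii
    proof eventually_elim
      fix R assume R: "0 < R \<and> ereal R \<le> max_radius k"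
      show "1 - ramp 0 y R / y\<^sup>2 \<le> indicator {0<..y} R"
      proof (cases "R \<le> y")
        case False
        then have "y\<^sup>2 \<le> R\<^sup>2" using y by (intro power_mono) auto
        then show ?thesis using y by (simp add: ramp_def)
      qed (use R y in simp)
    qed
  qed (simp_all add: emeasure_eq_measure)
  moreover have "(\<integral>R. indicator {0<..y} R \<partial>\<sigma>) \<le> e"
  proof -
    have "emeasure \<sigma> {0<..y} \<le> ennreal e"
      using emeasure_mixing_Ioc_le[of 1 y] y mass e by auto
    then show ?thesis using e by (simp add: emeasure_eq_measure)
  qed
  ultimately show ?thesis by linarith
qed

text \<open>One \<open>y\<close>, chosen from \<mu> alone, serves every curvature. The three thirds
  of \<open>e\<close> pay for replacing 1 by the scaled ramp under \<sigma>, for the change of the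
  ramp integral, and for the replacement at curvature 0.\<close>

lemma mixing_mass_near_curvature_zero:
  assumes base: "section_mixture \<sigma>\<^sub>0 \<mu> d 0" and e: "0 < e"
  obtains \<delta> where "\<delta> > 0"
    "\<And>k \<sigma>. \<bar>k\<bar> < \<delta> \<Longrightarrow> section_mixture \<sigma> \<mu> d k \<Longrightarrow> \<bar>measure \<sigma> UNIV - measure \<sigma>\<^sub>0 UNIV\<bar> \<le> e"
proof -
  interpret base: section_mixture \<sigma>\<^sub>0 \<mu> d 0 by fact
  have "0 < e / 3" using e by simp
  then obtain y where y: "0 < y" "y \<le> 1" "(\<integral>\<^sup>+x. ennreal (1 / x) * indicator {0<..y} x \<partial>\<mu>) < ennreal (e / 3)"
    using nn_integral_reciprocal_Ioc_small[OF base.mu.events_eq_borel nn_integral_reciprocal_finite[OF base]] by blast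
  have "0 < e / 3 * y\<^sup>2" using e y by simp
  from integral_ramp_near_curvature_zero[OF base order.refl y(1) this] obtain \<delta>1 where \<delta>1: "\<delta>1 > 0"
    and ramp: "\<And>k \<sigma>. \<bar>k\<bar> < \<delta>1 \<Longrightarrow> section_mixture \<sigma> \<mu> d k \<Longrightarrow>
      \<bar>(\<integral>R. ramp 0 y R \<partial>\<sigma>) - (\<integral>R. ramp 0 y R \<partial>\<sigma>\<^sub>0)\<bar> \<le> e / 3 * y\<^sup>2" by blast
  obtain \<delta>2 where \<delta>2: "\<delta>2 > 0" and mass: "\<And>k R. \<bar>k\<bar> < \<delta>2 \<Longrightarrow> 0 \<le> R \<Longrightarrow> min R 1 \<le> gcos_mass d k R"
    using gcos_mass_ge_min[OF zero_less_one, of d] by blast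
  have m: "\<bar>measure \<sigma> UNIV - (\<integral>R. ramp 0 y R \<partial>\<sigma>) / y\<^sup>2\<bar> \<le> e / 3"
    if "\<bar>k\<bar> < \<delta>2" "section_mixture \<sigma> \<mu> d k" for k \<sigma>
    using that(1) y e mass
    by (intro section_mixture.measure_mixing_minus_ramp[OF that(2)]) auto
  show thesis
  proof (rule that[of "min \<delta>1 \<delta>2"])
    show "min \<delta>1 \<delta>2 > 0" using \<delta>1 \<delta>2 by simp
    fix k \<sigma> assume k: "\<bar>k\<bar> < min \<delta>1 \<delta>2" and mix: "section_mixture \<sigma> \<mu> d k"
    have "\<bar>(\<integral>R. ramp 0 y R \<partial>\<sigma>) - (\<integral>R. ramp 0 y R \<partial>\<sigma>\<^sub>0)\<bar> / y\<^sup>2 \<le> e / 3"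
      using ramp[OF _ mix] k y by (simp add: pos_divide_le_eq)
    then have "\<bar>(\<integral>R. ramp 0 y R \<partial>\<sigma>) / y\<^sup>2 - (\<integral>R. ramp 0 y R \<partial>\<sigma>\<^sub>0) / y\<^sup>2\<bar> \<le> e / 3"
      by (simp add: diff_divide_distrib[symmetric])
    moreover note m[OF _ mix] m[OF _ base]
    ultimately show "\<bar>measure \<sigma> UNIV - measure \<sigma>\<^sub>0 UNIV\<bar> \<le> e"
      using k \<delta>2 by linarith
  qed
qed

section \<open>From unfoldings to mixtures, and the limit\<close>

lemma section_mixture_of_unfolding:
  assumes unf: "is_unfolding d k \<mu> \<nu>" and \<mu>: "real_distribution \<mu>" "AE r in \<mu>. 0 < r"
  obtains c where "c > 0" "section_mixture (density \<nu> (\<lambda>_. ennreal c)) \<mu> d k"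
proof -
  interpret mu: real_distribution \<mu> by fact
  have law: "radius_law k \<nu>" "radius_law k \<mu>" and fin: "section_mass d k \<nu> < \<infinity>"
    and tail: "\<And>r. 0 \<le> r \<Longrightarrow> ereal r < max_radius k \<Longrightarrow> emeasure \<mu> (radii_above k r) =
      (\<integral>\<^sup>+R\<in>radii_above k r. gcos_integral d k (alpha k R r) \<partial>\<nu>) / section_mass d k \<nu>"
    using unf by (auto simp: is_unfolding_def is_section_law_def)
  interpret nu: real_distribution \<nu> using law by (simp add: radius_law_def)
  have meas: "radii_above k r \<in> sets borel" for r unfolding radii_above_def by measurable
  have above_mu: "AE R in \<mu>. R \<in> radii_above k 0" and above_nu: "AE R in \<nu>. R \<in> radii_above k 0"
    using law by (auto simp: radius_law_def)
  have kernel: "gcos_integral d k (alpha k R r) * indicator (radii_above k r) R = ennreal (section_kernel d k R r)"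
    if "0 \<le> r" for r R
    using that by (auto simp: radii_above_def section_kernel_def ennreal_gcos_mass)
  have mass: "section_mass d k \<nu> = (\<integral>\<^sup>+R. ennreal (section_kernel d k R 0) \<partial>\<nu>)"
    unfolding section_mass_def
  proof (rule nn_integral_cong)
    fix R
    show "gcos_integral d k R * indicator (radii_above k 0) R = ennreal (section_kernel d k R 0)"
    proof (cases "0 < R \<and> ereal R \<le> max_radius k")
      case True
      then show ?thesis by (simp add: radii_above_def section_kernel_zero_right ennreal_gcos_mass)
    qed (auto simp: radii_above_def section_kernel_def)
  qed
  define c where "c = 1 / enn2real (section_mass d k \<nu>)"
  have "0 < max_radius k" by (simp add: max_radius_def zero_ereal_def)
  then have "emeasure \<mu> (radii_above k 0) = section_mass d k \<nu> / section_mass d k \<nu>"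
    using tail[of 0] by (simp add: kernel mass zero_ereal_def)
  moreover have "emeasure \<mu> (radii_above k 0) = 1"
    using above_mu meas by (subst mu.emeasure_eq_1_AE) auto
  \<comment> \<open>In \<open>ennreal\<close> the quotient 0 / 0 is 0, whereas the tail at
    \<open>r = 0\<close> equals 1.\<close>
  ultimately have "section_mass d k \<nu> \<noteq> 0" by auto
  then have pos: "0 < enn2real (section_mass d k \<nu>)" using fin by (simp add: enn2real_positive_iff zero_less_iff_neq_zero)
  then have c: "0 < c" by (simp add: c_def)
  have div: "a / section_mass d k \<nu> = ennreal c * a" for a
  proof -
    have "section_mass d k \<nu> = ennreal (enn2real (section_mass d k \<nu>))" using fin by simp
    then have "inverse (section_mass d k \<nu>) = ennreal c"
      using pos by (metis c_def inverse_ennreal inverse_eq_divide)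
    then show ?thesis by (simp add: divide_ennreal_def mult.commute)
  qed
  have "section_mixture (density \<nu> (\<lambda>_. ennreal c)) \<mu> d k"
  proof (intro section_mixture.intro section_mixture_axioms.intro finite_measureI)
    show "emeasure (density \<nu> (\<lambda>_. ennreal c)) (space (density \<nu> (\<lambda>_. ennreal c))) \<noteq> \<infinity>"
      using nu.emeasure_space_1 by (simp add: emeasure_density)
    show "real_distribution \<mu>" by fact
    show "sets (density \<nu> (\<lambda>_. ennreal c)) = sets borel" by simp
    show "AE R in density \<nu> (\<lambda>_. ennreal c). 0 < R \<and> ereal R \<le> max_radius k"
      using above_nu by (subst AE_density) (auto simp: radii_above_def elim!: eventually_mono)
    show "AE r in \<mu>. 0 < r" by fact
    fix r :: real assume r: "0 \<le> r"
    have "(\<integral>\<^sup>+R. ennreal (section_kernel d k R r) \<partial>density \<nu> (\<lambda>_. ennreal c)) =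
        ennreal c * (\<integral>\<^sup>+R. ennreal (section_kernel d k R r) \<partial>\<nu>)"
      by (subst nn_integral_density) (auto simp: nn_integral_cmult)
    moreover have "emeasure \<mu> {r<..} = ennreal c * (\<integral>\<^sup>+R. ennreal (section_kernel d k R r) \<partial>\<nu>)"
    proof (cases "ereal r < max_radius k")
      case True
      have "emeasure \<mu> {r<..} = emeasure \<mu> (radii_above k r)"
      proof (rule emeasure_eq_AE)
        show "AE R in \<mu>. (R \<in> {r<..}) = (R \<in> radii_above k r)"
          using above_mu by eventually_elim (auto simp: radii_above_def)
      qed (use meas in auto)
      then show ?thesis using tail[OF r True] by (simp add: kernel[OF r] div)
    next
      case False
      then have "section_kernel d k R r = 0" for R
        by (auto simp: section_kernel_def not_less) (meson ereal_less_eq(3) leD order_trans)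
      moreover have "emeasure \<mu> {r<..} = emeasure \<mu> {}"
      proof (rule emeasure_eq_AE)
        show "AE R in \<mu>. (R \<in> {r<..}) = (R \<in> {})"
          using above_mu
        proof eventually_elim
          fix R assume "R \<in> radii_above k 0"
          then have "ereal R \<le> max_radius k" "max_radius k \<le> ereal r"
            using False by (auto simp: radii_above_def)
          then have "ereal R \<le> ereal r" by (rule order.trans)
          then show "(R \<in> {r<..}) = (R \<in> {})" by simp
        qed
      qed auto
      ultimately show ?thesis by simp
    qed
    ultimately show "emeasure \<mu> {r<..} = (\<integral>\<^sup>+R. ennreal (section_kernel d k R r) \<partial>density \<nu> (\<lambda>_. ennreal c))"
      by simp
  qed
  with c show thesis by (rule that)
qed

theorem theorem6p2:
  fixes d :: nat and \<mu> :: "real measure" and \<nu> :: "real \<Rightarrow> real measure"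
  assumes "2 \<le> d"
    and "real_distribution \<mu>" and "AE r in \<mu>. 0 < r"
    and "\<And>k. k \<in> admissible_curvatures d \<mu> \<Longrightarrow> is_unfolding d k \<mu> (\<nu> k)"
    and "0 \<in> admissible_curvatures d \<mu>"
    and "0 islimpt admissible_curvatures d \<mu>"
  shows "weakly_tendsto \<nu> (\<nu> 0) (at 0 within admissible_curvatures d \<mu>)"
proof -
  define K where "K = admissible_curvatures d \<mu>"
  have "\<exists>c>0. section_mixture (density (\<nu> k) (\<lambda>_. ennreal c)) \<mu> d k" if "k \<in> K" for k
    using section_mixture_of_unfolding[OF assms(4) assms(2,3)] that unfolding K_def by metis
  then obtain c where c: "\<And>k. k \<in> K \<Longrightarrow> 0 < c k"
    and mix: "\<And>k. k \<in> K \<Longrightarrow> section_mixture (density (\<nu> k) (\<lambda>_. ennreal (c k))) \<mu> d k" by metis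
  have K0: "0 \<in> K" using assms(5) by (simp add: K_def)
  have law: "real_distribution (\<nu> k)" "AE R in \<nu> k. 0 < R" if "k \<in> K" for k
    using assms(4) that by (auto simp: K_def is_unfolding_def radius_law_def radii_above_def elim!: eventually_mono)
  \<comment> \<open>The normalising constant is recovered as the total mass of the mixing measure,
    because \<open>\<nu> k\<close> is a probability measure.\<close>
  have mass: "measure (density (\<nu> k) (\<lambda>_. ennreal (c k))) UNIV = c k" if "k \<in> K" for k
  proof -
    interpret real_distribution "\<nu> k" using law that by blast
    show ?thesis using c[OF that] emeasure_space_1 by (simp add: measure_def emeasure_density)
  qed
  have int: "(\<integral>R. ramp x y R \<partial>density (\<nu> k) (\<lambda>_. ennreal (c k))) = c k * (\<integral>R. ramp x y R \<partial>\<nu> k)" if "k \<in> K" for k x y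
  proof -
    interpret real_distribution "\<nu> k" using law that by blast
    show ?thesis using c[OF that] by (subst integral_density) auto
  qed
  show ?thesis
    unfolding weakly_tendsto_def K_def[symmetric] tendsto_at_iff_sequentially comp_def
  proof (intro allI impI)
    fix f :: "real \<Rightarrow> real" and X :: "nat \<Rightarrow> real"
    assume f: "continuous_on UNIV f \<and> bounded (range f)" and X: "\<forall>i. X i \<in> K - {0}" "X \<longlonglongrightarrow> 0"
    have XK: "X n \<in> K" for n using X by blast
    have near: "eventually (\<lambda>n. \<bar>X n\<bar> < \<delta>) sequentially" if "0 < \<delta>" for \<delta>
      using X(2) that by (auto simp: tendsto_iff dist_real_def)
    have lim_c: "(\<lambda>n. c (X n)) \<longlonglongrightarrow> c 0"
    proof (rule tendstoI)
      fix e :: real assume "0 < e"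
      then have "0 < e / 2" by simp
      then obtain \<delta> where \<delta>: "0 < \<delta>" "\<And>k \<sigma>. \<bar>k\<bar> < \<delta> \<Longrightarrow> section_mixture \<sigma> \<mu> d k \<Longrightarrow>
          \<bar>measure \<sigma> UNIV - measure (density (\<nu> 0) (\<lambda>_. ennreal (c 0))) UNIV\<bar> \<le> e / 2"
        using mixing_mass_near_curvature_zero[OF mix[OF K0]] by metis
      show "eventually (\<lambda>n. dist (c (X n)) (c 0) < e) sequentially"
        using near[OF \<delta>(1)]
      proof eventually_elim
        case (elim n)
        then show ?case using \<delta>(2)[OF elim mix[OF XK]] \<open>0 < e\<close> by (simp add: mass XK K0 dist_real_def)
      qed
    qed
    have lim_ramp: "(\<lambda>n. c (X n) * (\<integral>R. ramp x y R \<partial>\<nu> (X n))) \<longlonglongrightarrow> c 0 * (\<integral>R. ramp x y R \<partial>\<nu> 0)"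
      if xy: "0 \<le> x" "x < y" for x y
    proof (rule tendstoI)
      fix e :: real assume "0 < e"
      then have "0 < e / 2" by simp
      then obtain \<delta> where \<delta>: "0 < \<delta>" "\<And>k \<sigma>. \<bar>k\<bar> < \<delta> \<Longrightarrow> section_mixture \<sigma> \<mu> d k \<Longrightarrow>
          \<bar>(\<integral>R. ramp x y R \<partial>\<sigma>) - (\<integral>R. ramp x y R \<partial>density (\<nu> 0) (\<lambda>_. ennreal (c 0)))\<bar> \<le> e / 2"
        using integral_ramp_near_curvature_zero[OF mix[OF K0] xy] by metis
      show "eventually (\<lambda>n. dist (c (X n) * (\<integral>R. ramp x y R \<partial>\<nu> (X n))) (c 0 * (\<integral>R. ramp x y R \<partial>\<nu> 0)) < e) sequentially"
        using near[OF \<delta>(1)]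
      proof eventually_elim
        case (elim n)
        then show ?case using \<delta>(2)[OF elim mix[OF XK]] \<open>0 < e\<close> by (simp add: int XK K0 dist_real_def)
      qed
    qed
    show "(\<lambda>n. \<integral>x. f x \<partial>\<nu> (X n)) \<longlonglongrightarrow> (\<integral>x. f x \<partial>\<nu> 0)"
    proof (rule integral_tendsto_of_integral_ramp)
      fix x y :: real assume xy: "0 \<le> x" "x < y"
      have "c 0 \<noteq> 0" using c[OF K0] by simp
      \<comment> \<open>The mixing measures converge only together with their unknown masses;
        dividing by the limit of the masses returns to the probability laws.\<close>
      from tendsto_divide[OF lim_ramp[OF xy] lim_c this]
      show "(\<lambda>n. \<integral>R. ramp x y R \<partial>\<nu> (X n)) \<longlonglongrightarrow> (\<integral>R. ramp x y R \<partial>\<nu> 0)"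
        using c[OF XK] c[OF K0] by (simp add: less_imp_neq[symmetric])
    qed (use law XK K0 f in auto)
  qed
qed

end
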